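(* Let $\Psi$ be a unit-length generalized Killing spinor on the round sphere $\mathbb{S}^3$, written as $\Psi=V\cdot\Phi+\alpha\Phi$ with $\Phi=[\tilde u,1]$, $V$ a vector field and $\alpha$ a function. If $\alpha$ is constant, then either $\Psi$ is a Killing spinor with Killing constant $\tfrac12$ (i.e. $\nabla_X\Psi=\tfrac12X\cdot\Psi$ for all $X$), or $\alpha=0$ and $\Psi=\xi\cdot\Phi$ for a right-invariant unit vector field $\xi$ (i.e. $\xi_g=bg$ for some unit $b\in\mathrm{Im}\,\mathbb{H}$), so that $\Psi$ is the Clifford product of a right-invariant vector field with a Killing spinor of constant $\tfrac12$.
   Context: $\mathbb{S}^3\subset\mathbb{H}$ is the unit sphere with round metric and group structure, $u(g)=(gi,gj,gk)$ the left-invariant orthonormal frame defining the orientation, $\tilde u$ a lift to the spin bundle; spinors are $[\tilde u,f]$ with $f:\mathbb{S}^3\to\mathbb{H}$ and Clifford multiplication by $gx$ acting by $f\mapsto xf$. $\Phi=[\tilde u,1]$ satisfies $\nabla_X\Phi=\tfrac12X\cdot\Phi$. Every spinor can be uniquely written as $V\cdot\Phi+\alpha\Phi$ with $V$ a vector field and $\alpha$ a real function. A generalized Killing spinor is $\Psi$ with $\nabla_X\Psi=A(X)\cdot\Psi$ for all $X$, for some symmetric endomorphism field $A$. *)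

theory Defs
  imports "HOL-Analysis.Analysis"
begin

text \<open>Quaternions H modelled as R^4 = real x real x real x real, with components
  (a,b,c,d) standing for a + b i + c j + d k.  The Euclidean norm and inner
  product of the product type are the standard ones on H.\<close>

type_synonym quat = "real \<times> real \<times> real \<times> real"

fun qmul :: "quat \<Rightarrow> quat \<Rightarrow> quat" where
  "qmul (a1, b1, c1, d1) (a2, b2, c2, d2) =
     (a1*a2 - b1*b2 - c1*c2 - d1*d2,
      a1*b2 + b1*a2 + c1*d2 - d1*c2,
      a1*c2 - b1*d2 + c1*a2 + d1*b2,
      a1*d2 + b1*c2 - c1*b2 + d1*a2)"

fun qcnj :: "quat \<Rightarrow> quat" where
  "qcnj (a, b, c, d) = (a, -b, -c, -d)"

definition qre :: "quat \<Rightarrow> real" where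
  "qre q = fst q"

definition qreal :: "real \<Rightarrow> quat" where
  "qreal r = (r, 0, 0, 0)"

definition imq :: "quat \<Rightarrow> bool" where
  "imq x \<longleftrightarrow> qre x = 0"

definition S3 :: "quat set" where
  "S3 = sphere 0 1"

text \<open>Tangent vectors to S^3 at g (as vectors in H): X orthogonal to g,
  equivalently X = g x with x in Im H.\<close>
definition tangent :: "quat \<Rightarrow> quat \<Rightarrow> bool" where
  "tangent g X \<longleftrightarrow> inner X g = 0"

text \<open>Spinors are [u~, f] with f : S^3 \<rightarrow> H; we represent a spinor field by f.
  Clifford multiplication by the tangent vector X = g x at g acts by f(g) \<mapsto> x f(g),
  where x = g^{-1} X = conj(g) X.\<close>
definition clifford :: "quat \<Rightarrow> quat \<Rightarrow> quat \<Rightarrow> quat" where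
  "clifford g X s = qmul (qmul (qcnj g) X) s"

text \<open>Spinor covariant derivative: since Phi = [u~,1] satisfies nabla_X Phi = 1/2 X.Phi and
  the spinor bundle is a right H-module with H-linear connection,
  nabla_X [u~, f] = [u~, X(f) + 1/2 x f].\<close>
definition nabla :: "(quat \<Rightarrow> quat) \<Rightarrow> quat \<Rightarrow> quat \<Rightarrow> quat" where
  "nabla f g X = frechet_derivative f (at g) X + (1/2) *\<^sub>R clifford g X (f g)"

fun dirderiv :: "quat list \<Rightarrow> (quat \<Rightarrow> 'a::real_normed_vector) \<Rightarrow> quat \<Rightarrow> 'a" where
  "dirderiv [] f = f"
| "dirderiv (v # vs) f = (\<lambda>x. frechet_derivative (dirderiv vs f) (at x) v)"

definition smooth_on :: "quat set \<Rightarrow> (quat \<Rightarrow> 'a::real_normed_vector) \<Rightarrow> bool" where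
  "smooth_on U f \<longleftrightarrow> open U \<and> (\<forall>vs. \<forall>x\<in>U. dirderiv vs f differentiable (at x))"

text \<open>A smooth spinor field on S^3: the H-valued function is the restriction of a
  smooth function on an open neighbourhood of S^3 (only values on S^3 matter).\<close>
definition smooth_spinor :: "(quat \<Rightarrow> quat) \<Rightarrow> bool" where
  "smooth_spinor f \<longleftrightarrow> (\<exists>U. S3 \<subseteq> U \<and> smooth_on U f)"

definition sym_endo :: "quat \<Rightarrow> (quat \<Rightarrow> quat) \<Rightarrow> bool" where
  "sym_endo g A \<longleftrightarrow> linear A \<and> (\<forall>X. tangent g X \<longrightarrow> tangent g (A X))
     \<and> (\<forall>X Y. tangent g X \<longrightarrow> tangent g Y \<longrightarrow> inner (A X) Y = inner X (A Y))"

definition gen_killing :: "(quat \<Rightarrow> quat) \<Rightarrow> bool" where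
  "gen_killing f \<longleftrightarrow> (\<exists>A :: quat \<Rightarrow> quat \<Rightarrow> quat.
     \<forall>g\<in>S3. sym_endo g (A g) \<and>
       (\<forall>X. tangent g X \<longrightarrow> nabla f g X = clifford g (A g X) (f g)))"

definition killing :: "real \<Rightarrow> (quat \<Rightarrow> quat) \<Rightarrow> bool" where
  "killing c f \<longleftrightarrow> (\<forall>g\<in>S3. \<forall>X. tangent g X \<longrightarrow> nabla f g X = c *\<^sub>R clifford g X (f g))"

end

theory Submission
  imports Defs
begin

text \<open>
  Write \<open>f = c + h\<close> with \<open>c\<close> the constant real part and \<open>h\<close> imaginary, and let \<open>L x\<close> be the
  derivative along the left-invariant field \<open>g x\<close>.  The generalized Killing equation reads
  \<open>L x f = b(x) f\<close> with \<open>b\<close> symmetric (\<open>b = A - 1/2\<close>), and constancy of the real part gives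
  \<open>b(h) = 0\<close>.  Commuting derivatives yields the Codazzi equation
  \<open>L x (b y) - L y (b x) = 2 b(x \<times> y) + 2 b(x) \<times> b(y)\<close>.  Its component along \<open>h\<close> forces the two
  remaining eigenvalues to satisfy \<open>l m = - (l + m)\<close>; if \<open>c \<noteq> 0\<close>, differentiating this relation
  along \<open>h\<close> gives \<open>b = 0\<close>, i.e. \<open>f\<close> is Killing.

  If \<open>c = 0\<close>, put \<open>\<tau> = tr b\<close>, so that \<open>tr b\<^sup>2 = \<tau>\<^sup>2 + 2 \<tau>\<close> and \<open>\<tau> (\<tau> + 4) = (l - m)\<^sup>2 \<ge> 0\<close>.  A
  Simons-type identity at a critical point of \<open>\<tau>\<close> gives
  \<open>(1 + m) \<tau>\<^sub>u\<^sub>u + (1 + l) \<tau>\<^sub>v\<^sub>v + (1 + \<tau>) \<tau>\<^sub>w\<^sub>w = |\<nabla>b|\<^sup>2 - 4 \<tau>\<^sup>2 \<ge> 2 \<tau> (\<tau> + 4)\<close>,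
  and since \<open>(1 + l) (1 + m) = 1\<close> the maximum principle excludes a maximum with \<open>\<tau> > 0\<close> and a
  minimum with \<open>\<tau> < -4\<close>.  By connectedness \<open>\<tau> = 0\<close> everywhere, whence \<open>b = 0\<close>, or \<open>\<tau> = -4\<close>
  everywhere, in which case \<open>g f g\<^sup>-\<^sup>1\<close> has zero derivative.
\<close>

subsection \<open>Higher derivatives\<close>

text \<open>The mean value theorem along \<open>a\<close>, applied to the increment of
  \<open>F\<close> in the direction \<open>b\<close>, turns the second difference into an increment
  of the derivative along \<open>a\<close>. Differentiability of that derivative at \<open>x\<close>
  then gives the leading term.\<close>

lemma second_difference_quotient:
  fixes F :: "'a::real_normed_vector \<Rightarrow> real"
  assumes U: "open U" "x \<in> U"
    and F: "\<And>y. y \<in> U \<Longrightarrow> F differentiable (at y)"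
    and G: "(\<lambda>y. frechet_derivative F (at y) a) differentiable (at x)"
    and e: "e > 0"
  shows "\<exists>d>0. \<forall>t. 0 < t \<and> t < d \<longrightarrow>
    \<bar>F (x + t *\<^sub>R a + t *\<^sub>R b) - F (x + t *\<^sub>R a) - F (x + t *\<^sub>R b) + F x
      - t\<^sup>2 * frechet_derivative (\<lambda>y. frechet_derivative F (at y) a) (at x) b\<bar> \<le> e * t\<^sup>2"
proof -
  define G where "G = (\<lambda>y. frechet_derivative F (at y) a)"
  define G' where "G' = frechet_derivative G (at x)"
  define M where "M = norm a + norm b + 1"
  have M: "M > 0" "norm a + norm b \<le> M" unfolding M_def by (auto intro: add_nonneg_pos)
  have Gd: "(G has_derivative G') (at x)"
    using assms(4) by (simp add: G'_def G_def frechet_derivative_works[symmetric])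
  then have linG: "linear G'" by (rule has_derivative_linear)
  \<comment> \<open>Two first-order approximations are compared below, each with error at most
    \<open>e' * (t * M)\<close>; the factor 2 makes them add up to \<open>e * t\<close>.\<close>
  define e' where "e' = e / (2 * M)"
  have e': "e' > 0" using e M by (simp add: e'_def)
  obtain d1 where d1: "d1 > 0" "\<And>y. norm (y - x) < d1 \<Longrightarrow> norm (G y - G x - G' (y - x)) \<le> e' * norm (y - x)"
    using Gd e' unfolding has_derivative_at_alt by blast
  obtain d2 where d2: "d2 > 0" "ball x d2 \<subseteq> U"
    using U openE by blast
  \<comment> \<open>Dividing by \<open>M\<close> keeps every point of the parallelogram spanned by
    \<open>t *\<^sub>R a\<close> and \<open>t *\<^sub>R b\<close> at \<open>x\<close> within both
    radii.\<close>
  define d where "d = min d1 d2 / M"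
  show ?thesis
  proof (intro exI[of _ d] conjI allI impI)
    show "d > 0" using d1 d2 M by (simp add: d_def)
    fix t :: real assume t: "0 < t \<and> t < d"
    have tM: "t * M < min d1 d2" using t M by (simp add: d_def field_simps)
    have small: "norm (s *\<^sub>R a + r *\<^sub>R b) \<le> t * M" if "0 \<le> s" "s \<le> t" "0 \<le> r" "r \<le> t" for s r
    proof -
      have "norm (s *\<^sub>R a + r *\<^sub>R b) \<le> s * norm a + r * norm b"
        using that by (intro order_trans[OF norm_triangle_ineq]) simp
      also have "\<dots> \<le> t * norm a + t * norm b"
        using that by (intro add_mono mult_right_mono) auto
      also have "\<dots> \<le> t * M" using M(2) t
        by (metis distrib_left less_imp_le mult_left_mono)
      finally show ?thesis .
    qed
    have inU: "x + s *\<^sub>R a + r *\<^sub>R b \<in> U" if "0 \<le> s" "s \<le> t" "0 \<le> r" "r \<le> t" for s r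
    proof -
      have "dist x (x + (s *\<^sub>R a + r *\<^sub>R b)) < d2"
        using small[OF that] tM unfolding dist_commute[of x] by (simp add: dist_norm)
      then show ?thesis using d2 by (auto simp: add.assoc)
    qed
    \<comment> \<open>The second difference is \<open>\<phi> t - \<phi> 0\<close>.\<close>
    define \<phi> where "\<phi> = (\<lambda>s. F (x + s *\<^sub>R a + t *\<^sub>R b) - F (x + s *\<^sub>R a))"
    have der: "((\<lambda>s. F (x + s *\<^sub>R a + r *\<^sub>R b)) has_real_derivative G (x + s *\<^sub>R a + r *\<^sub>R b)) (at s)"
      if "0 \<le> s" "s \<le> t" "0 \<le> r" "r \<le> t" for s r
    proof -
      let ?D = "frechet_derivative F (at (x + s *\<^sub>R a + r *\<^sub>R b))"
      have D: "(F has_derivative ?D) (at (x + s *\<^sub>R a + r *\<^sub>R b))"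
        using F[OF inU[OF that]] by (simp add: frechet_derivative_works[symmetric])
      have "((\<lambda>s. F (x + s *\<^sub>R a + r *\<^sub>R b)) has_derivative (\<lambda>k. ?D (k *\<^sub>R a))) (at s)"
        by (rule has_derivative_compose[where f = "\<lambda>s. x + s *\<^sub>R a + r *\<^sub>R b" and g = F, OF _ D])
           (auto intro!: derivative_eq_intros)
      moreover have "(\<lambda>k. ?D (k *\<^sub>R a)) = (*) (?D a)"
        using linear_scale[OF has_derivative_linear[OF D]] by (auto simp: mult.commute)
      ultimately show ?thesis
        by (simp add: has_field_derivative_def G_def)
    qed
    have "\<exists>z. 0 < z \<and> z < t \<and> \<phi> t - \<phi> 0 = (t - 0) * (G (x + z *\<^sub>R a + t *\<^sub>R b) - G (x + z *\<^sub>R a))"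
    proof (rule MVT2)
      fix s assume s: "0 \<le> s" "s \<le> t"
      show "(\<phi> has_real_derivative G (x + s *\<^sub>R a + t *\<^sub>R b) - G (x + s *\<^sub>R a)) (at s)"
        unfolding \<phi>_def using DERIV_diff[OF der[of s t] der[of s 0]] s t by simp
    qed (use t in auto)
    then obtain z where z: "0 < z" "z < t"
      "\<phi> t - \<phi> 0 = t * (G (x + z *\<^sub>R a + t *\<^sub>R b) - G (x + z *\<^sub>R a))" by auto
    have approx: "\<bar>G (x + y) - G x - G' y\<bar> \<le> e' * (t * M)" if "norm y \<le> t * M" for y
    proof -
      have "norm ((x + y) - x) < d1" using that tM by simp
      from d1(2)[OF this] have "\<bar>G (x + y) - G x - G' y\<bar> \<le> e' * norm y" by simp
      also have "\<dots> \<le> e' * (t * M)" using that e' by (intro mult_left_mono) auto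
      finally show ?thesis .
    qed
    have "\<bar>G (x + (z *\<^sub>R a + t *\<^sub>R b)) - G x - G' (z *\<^sub>R a + t *\<^sub>R b)\<bar> \<le> e' * (t * M)"
      using z t by (intro approx small) auto
    moreover have "\<bar>G (x + (z *\<^sub>R a + 0 *\<^sub>R b)) - G x - G' (z *\<^sub>R a + 0 *\<^sub>R b)\<bar> \<le> e' * (t * M)"
      using z t by (intro approx small) auto
    moreover have "G' (z *\<^sub>R a + t *\<^sub>R b) = G' (z *\<^sub>R a) + t * G' b"
      using linear_add[OF linG] linear_scale[OF linG] by simp
    ultimately have "\<bar>(G (x + z *\<^sub>R a + t *\<^sub>R b) - G (x + z *\<^sub>R a)) - t * G' b\<bar> \<le> 2 * e' * (t * M)"
      by (simp add: add.assoc)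
    also have "2 * e' * (t * M) = e * t" using M by (simp add: e'_def)
    finally have "t * \<bar>(G (x + z *\<^sub>R a + t *\<^sub>R b) - G (x + z *\<^sub>R a)) - t * G' b\<bar> \<le> t * (e * t)"
      using t by (intro mult_left_mono) auto
    moreover have "t * \<bar>(G (x + z *\<^sub>R a + t *\<^sub>R b) - G (x + z *\<^sub>R a)) - t * G' b\<bar>
        = \<bar>\<phi> t - \<phi> 0 - t\<^sup>2 * G' b\<bar>"
    proof -
      have "t * \<bar>(G (x + z *\<^sub>R a + t *\<^sub>R b) - G (x + z *\<^sub>R a)) - t * G' b\<bar>
        = \<bar>t * ((G (x + z *\<^sub>R a + t *\<^sub>R b) - G (x + z *\<^sub>R a)) - t * G' b)\<bar>"
        using t by (simp add: abs_mult)
      also have "\<dots> = \<bar>\<phi> t - \<phi> 0 - t\<^sup>2 * G' b\<bar>"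
        using z(3) by (simp add: algebra_simps power2_eq_square)
      finally show ?thesis .
    qed
    ultimately show "\<bar>F (x + t *\<^sub>R a + t *\<^sub>R b) - F (x + t *\<^sub>R a) - F (x + t *\<^sub>R b) + F x
      - t\<^sup>2 * frechet_derivative (\<lambda>y. frechet_derivative F (at y) a) (at x) b\<bar> \<le> e * t\<^sup>2"
      unfolding \<phi>_def G'_def G_def by (simp add: algebra_simps power2_eq_square)
  qed
qed

text \<open>The second difference is symmetric in \<open>a\<close> and \<open>b\<close>, and both
  iterated derivatives are its limit after division by \<open>t\<^sup>2\<close>.\<close>

lemma symmetric_second_derivative_real:
  fixes F :: "'a::real_normed_vector \<Rightarrow> real"
  assumes U: "open U" "x \<in> U"
    and F: "\<And>y. y \<in> U \<Longrightarrow> F differentiable (at y)"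
    and F2: "\<And>a. (\<lambda>y. frechet_derivative F (at y) a) differentiable (at x)"
  shows "frechet_derivative (\<lambda>y. frechet_derivative F (at y) a) (at x) b
       = frechet_derivative (\<lambda>y. frechet_derivative F (at y) b) (at x) a" (is "?A = ?B")
proof -
  have "\<bar>?A - ?B\<bar> \<le> e" if e: "e > 0" for e
  proof -
    have e2: "e/2 > 0" using e by simp
    obtain d1 where d1: "d1 > 0" "\<And>t. 0 < t \<Longrightarrow> t < d1 \<Longrightarrow>
      \<bar>F (x + t *\<^sub>R a + t *\<^sub>R b) - F (x + t *\<^sub>R a) - F (x + t *\<^sub>R b) + F x - t\<^sup>2 * ?A\<bar> \<le> e/2 * t\<^sup>2"
      using second_difference_quotient[OF U F F2 e2, of a b] by blast
    obtain d2 where d2: "d2 > 0" "\<And>t. 0 < t \<Longrightarrow> t < d2 \<Longrightarrow>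
      \<bar>F (x + t *\<^sub>R b + t *\<^sub>R a) - F (x + t *\<^sub>R b) - F (x + t *\<^sub>R a) + F x - t\<^sup>2 * ?B\<bar> \<le> e/2 * t\<^sup>2"
      using second_difference_quotient[OF U F F2 e2, of b a] by blast
    define t where "t = min d1 d2 / 2"
    have t: "0 < t" "t < d1" "t < d2" using d1 d2 by (auto simp: t_def)
    have "\<bar>t\<^sup>2 * ?A - t\<^sup>2 * ?B\<bar> \<le> e * t\<^sup>2"
    proof -
      let ?S = "F (x + t *\<^sub>R a + t *\<^sub>R b) - F (x + t *\<^sub>R a) - F (x + t *\<^sub>R b) + F x"
      have eq: "F (x + t *\<^sub>R b + t *\<^sub>R a) - F (x + t *\<^sub>R b) - F (x + t *\<^sub>R a) + F x = ?S"
        by (simp add: algebra_simps)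
      have "\<bar>?S - t\<^sup>2 * ?A\<bar> \<le> e/2 * t\<^sup>2" "\<bar>?S - t\<^sup>2 * ?B\<bar> \<le> e/2 * t\<^sup>2"
        using d1(2)[of t] d2(2)[of t, unfolded eq] t by auto
      then show ?thesis by linarith
    qed
    then have "t\<^sup>2 * \<bar>?A - ?B\<bar> \<le> t\<^sup>2 * e"
      by (simp add: right_diff_distrib[symmetric] abs_mult mult.commute)
    then show ?thesis using t by simp
  qed
  then have "\<bar>?A - ?B\<bar> \<le> 0" by (meson dense_ge)
  then show ?thesis by simp
qed

lemma frechet_derivative_inner_left:
  assumes "F differentiable (at x)"
  shows "frechet_derivative (\<lambda>y. F y \<bullet> c) (at x) v = frechet_derivative F (at x) v \<bullet> c"
proof -
  have "((\<lambda>y. F y \<bullet> c) has_derivative (\<lambda>v. frechet_derivative F (at x) v \<bullet> c)) (at x)"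
    using assms by (auto intro: has_derivative_inner_left simp: frechet_derivative_works[symmetric])
  from frechet_derivative_at[OF this] show ?thesis by metis
qed

text \<open>Pairing with an arbitrary vector \<open>c\<close> reduces the claim to real-valued
  functions.\<close>

lemma symmetric_second_derivative:
  fixes F :: "'a::real_normed_vector \<Rightarrow> 'b::real_inner"
  assumes U: "open U" "x \<in> U"
    and F: "\<And>y. y \<in> U \<Longrightarrow> F differentiable (at y)"
    and F2: "\<And>a y. y \<in> U \<Longrightarrow> (\<lambda>y. frechet_derivative F (at y) a) differentiable (at y)"
  shows "frechet_derivative (\<lambda>y. frechet_derivative F (at y) a) (at x) b
       = frechet_derivative (\<lambda>y. frechet_derivative F (at y) b) (at x) a"
proof -
  have *: "frechet_derivative (\<lambda>y. frechet_derivative F (at y) a) (at x) b \<bullet> c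
     = frechet_derivative (\<lambda>y. frechet_derivative (\<lambda>y. F y \<bullet> c) (at y) a) (at x) b"
    and dd: "(\<lambda>y. frechet_derivative (\<lambda>y. F y \<bullet> c) (at y) a) differentiable (at x)" for a b c
  proof -
    have d: "(\<lambda>y. frechet_derivative F (at y) a \<bullet> c) differentiable (at x)"
      using F2[OF U(2)] by (intro differentiable_inner) auto
    have eq: "\<And>y. y \<in> U \<Longrightarrow> frechet_derivative F (at y) a \<bullet> c = frechet_derivative (\<lambda>y. F y \<bullet> c) (at y) a"
      using F frechet_derivative_inner_left by metis
    show "frechet_derivative (\<lambda>y. frechet_derivative F (at y) a) (at x) b \<bullet> c
     = frechet_derivative (\<lambda>y. frechet_derivative (\<lambda>y. F y \<bullet> c) (at y) a) (at x) b"
      using frechet_derivative_transform_within_open[OF d U eq]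
        frechet_derivative_inner_left[OF F2[OF U(2)]] by metis
    show "(\<lambda>y. frechet_derivative (\<lambda>y. F y \<bullet> c) (at y) a) differentiable (at x)"
      using d eq U by (meson differentiable_def has_derivative_transform_within_open)
  qed
  have "frechet_derivative (\<lambda>y. frechet_derivative F (at y) a) (at x) b \<bullet> c
       = frechet_derivative (\<lambda>y. frechet_derivative F (at y) b) (at x) a \<bullet> c" for c
    unfolding * 
    by (rule symmetric_second_derivative_real[OF U _ dd])
       (use F in \<open>auto intro: differentiable_inner\<close>)
  then show ?thesis by (metis vector_eq_rdot)
qed

section \<open>Finite differentiability classes and their closure properties\<close>

text \<open>\<open>Ck 0\<close> imposes nothing, so \<open>Ck n\<close> means n-fold
  differentiability on \<open>U\<close>, with no continuity demanded of the last derivatives.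
  Closure properties then go by plain induction on \<open>n\<close>, and smoothness is
  \<open>Ck n\<close> for all \<open>n\<close>.\<close>

fun Ck :: "nat \<Rightarrow> 'a::real_normed_vector set \<Rightarrow> ('a \<Rightarrow> 'b::real_normed_vector) \<Rightarrow> bool" where
  "Ck 0 U F \<longleftrightarrow> True"
| "Ck (Suc n) U F \<longleftrightarrow> (\<forall>x\<in>U. F differentiable (at x)) \<and>
     (\<forall>v. Ck n U (\<lambda>x. frechet_derivative F (at x) v))"

lemma Ck_cong:
  assumes "open U" "\<And>x. x \<in> U \<Longrightarrow> F x = G x" "Ck n U F"
  shows "Ck n U G"
  using assms
proof (induction n arbitrary: F G)
  case (Suc n)
  have eq: "frechet_derivative F (at x) = frechet_derivative G (at x)" if "x \<in> U" for x
    using Suc.prems that by (intro frechet_derivative_transform_within_open[of F x U G]) auto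
  have "G differentiable (at x)" if "x \<in> U" for x
  proof -
    have "F differentiable (at x)" using Suc.prems(3) that by simp
    then obtain D where "(F has_derivative D) (at x)" by (auto simp: differentiable_def)
    then have "(G has_derivative D) (at x)"
      using Suc.prems(1) that Suc.prems(2) by (rule has_derivative_transform_within_open)
    then show ?thesis by (auto simp: differentiable_def)
  qed
  moreover have "Ck n U (\<lambda>x. frechet_derivative G (at x) v)" for v
    by (rule Suc.IH[of "\<lambda>x. frechet_derivative F (at x) v"]) (use Suc.prems eq in auto)
  ultimately show ?case by simp
qed simp

lemma Ck_Suc_imp: "Ck (Suc n) U F \<Longrightarrow> Ck n U F"
  by (induction n arbitrary: F) auto

text \<open>Allows the derivative to be given by an explicit formula, such as a product rule, in
  place of the chosen \<open>frechet_derivative\<close>.\<close>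

lemma Ck_SucI:
  assumes U: "open U"
    and D: "\<And>x. x \<in> U \<Longrightarrow> (F has_derivative F' x) (at x)"
    and C: "\<And>v. Ck n U (\<lambda>x. F' x v)"
  shows "Ck (Suc n) U F"
proof -
  have "Ck n U (\<lambda>x. frechet_derivative F (at x) v)" for v
    by (rule Ck_cong[OF U _ C[of v]]) (use frechet_derivative_at[OF D] in metis)
  then show ?thesis using D by (auto simp: differentiable_def)
qed

lemma Ck_const: "Ck n U (\<lambda>x. c)"
  by (induction n arbitrary: c) auto

lemma Ck_has_derivative:
  "Ck (Suc n) U F \<Longrightarrow> x \<in> U \<Longrightarrow> (F has_derivative frechet_derivative F (at x)) (at x)"
  by (simp add: frechet_derivative_works[symmetric])

lemma Ck_bounded_linear:
  assumes T: "bounded_linear T" and U: "open U" and F: "Ck n U F"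
  shows "Ck n U (\<lambda>x. T (F x))"
  using F
proof (induction n arbitrary: F)
  case (Suc n)
  show ?case
    by (rule Ck_SucI[OF U bounded_linear.has_derivative[OF T Ck_has_derivative[OF Suc.prems]]])
       (use Suc in auto)
qed simp

lemma Ck_add:
  assumes U: "open U" and "Ck n U F" "Ck n U G"
  shows "Ck n U (\<lambda>x. F x + G x)"
  using assms(2,3)
proof (induction n arbitrary: F G)
  case (Suc n)
  show ?case
    by (rule Ck_SucI[OF U has_derivative_add[OF Ck_has_derivative[OF Suc.prems(1)] Ck_has_derivative[OF Suc.prems(2)]]])
       (use Suc in auto)
qed simp

lemma Ck_bilinear:
  assumes bl: "bounded_bilinear pr" and U: "open U" and "Ck n U F" "Ck n U G"
  shows "Ck n U (\<lambda>x. pr (F x) (G x))"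
  using assms(3,4)
proof (induction n arbitrary: F G)
  case (Suc n)
  show ?case
  proof (rule Ck_SucI[OF U bounded_bilinear.FDERIV[OF bl Ck_has_derivative[OF Suc.prems(1)] Ck_has_derivative[OF Suc.prems(2)]]])
    fix v show "Ck n U (\<lambda>x. pr (F x) (frechet_derivative G (at x) v) + pr (frechet_derivative F (at x) v) (G x))"
      using Suc.prems Ck_Suc_imp[OF Suc.prems(1)] Ck_Suc_imp[OF Suc.prems(2)]
      by (intro Ck_add U Suc.IH) auto
  qed auto
qed simp

lemma Ck_diff:
  assumes U: "open U" and "Ck n U F" "Ck n U G"
  shows "Ck n U (\<lambda>x. F x - G x)"
  using Ck_add[OF U assms(2) Ck_bounded_linear[OF bounded_linear_minus[OF bounded_linear_ident] U assms(3)]] by simp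

lemma Ck_sum:
  assumes U: "open U" and "\<And>i. i \<in> I \<Longrightarrow> Ck n U (F i)"
  shows "Ck n U (\<lambda>x. \<Sum>i\<in>I. F i x)"
  using assms(2)
  by (induction I rule: infinite_finite_induct) (auto intro: Ck_const Ck_add[OF U])

lemma Ck_linear:
  assumes "bounded_linear T" "open U"
  shows "Ck n U T"
proof (cases n)
  case (Suc m)
  then show ?thesis
    using Ck_SucI[OF assms(2) bounded_linear.has_derivative[OF assms(1) has_derivative_ident]]
    by (auto intro: Ck_const)
qed simp

lemma smooth_on_imp_Ck:
  assumes "smooth_on U f"
  shows "Ck n U (dirderiv vs f)"
proof (induction n arbitrary: vs)
  case (Suc n)
  then show ?case using assms Suc[of "v # vs" for v] by (auto simp: smooth_on_def)
qed simp

subsection \<open>Left-invariant derivatives on the sphere\<close>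

definition iq :: "real^3 \<Rightarrow> quat" where
  "iq x = (0, x$1, x$2, x$3)"

definition vq :: "quat \<Rightarrow> real^3" where
  "vq q = vector [fst (snd q), fst (snd (snd q)), snd (snd (snd q))]"

lemma vq_iq [simp]: "vq (iq x) = x"
  by (simp add: vq_def iq_def vec_eq_iff forall_3)

lemma iq_vq: "iq (vq q) = q - qreal (qre q)"
  by (cases q) (simp add: vq_def iq_def qre_def qreal_def)

lemma iq_inject [simp]: "iq x = iq y \<longleftrightarrow> x = y"
  by (metis vq_iq)

lemma qre_iq [simp]: "qre (iq x) = 0"
  by (simp add: iq_def qre_def)

lemma inner_iq [simp]: "iq x \<bullet> iq y = x \<bullet> y"
  by (simp add: iq_def inner_vec_def sum_3)

lemma linear_iq: "linear iq"
  by (rule linearI) (auto simp: iq_def)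

lemma linear_vq: "linear vq"
  by (rule linearI) (auto simp: vq_def vec_eq_iff forall_3)

lemma iq_add: "iq (x + y) = iq x + iq y" and iq_diff: "iq (x - y) = iq x - iq y"
  and iq_scale: "iq (r *\<^sub>R x) = r *\<^sub>R iq x" and iq_minus: "iq (- x) = - iq x"
  by (auto simp: iq_def)

lemma qmul_assoc: "qmul (qmul p q) r = qmul p (qmul q r)"
  by (cases p; cases q; cases r) (simp add: algebra_simps)

lemma bilinear_qmul: "bilinear qmul"
  unfolding bilinear_def
proof (intro conjI allI)
  show "linear (\<lambda>y. qmul x y)" for x
    by (cases x) (auto intro!: linearI simp: algebra_simps)
  show "linear (\<lambda>x. qmul x y)" for y
    by (cases y) (auto intro!: linearI simp: algebra_simps)
qed

lemma bounded_bilinear_qmul: "bounded_bilinear qmul"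
  using bilinear_qmul bilinear_conv_bounded_bilinear by blast

lemma bounded_bilinear_cross3: "bounded_bilinear cross3"
  using bilinear_cross bilinear_conv_bounded_bilinear by blast

interpretation qmul: bounded_bilinear qmul by (rule bounded_bilinear_qmul)
interpretation cr: bounded_bilinear cross3 by (rule bounded_bilinear_cross3)

lemma qmul_real_left [simp]: "qmul (qreal r) q = r *\<^sub>R q"
  by (cases q) (simp add: qreal_def)

lemma qmul_real_right [simp]: "qmul q (qreal r) = r *\<^sub>R q"
  by (cases q) (simp add: qreal_def mult.commute)

lemma qmul_iq: "qmul (iq x) (iq y) = iq (cross3 x y) - qreal (x \<bullet> y)"
  by (simp add: iq_def qreal_def cross_components inner_vec_def sum_3 algebra_simps)

lemma qcnj_qmul: "qcnj (qmul p q) = qmul (qcnj q) (qcnj p)"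
  by (cases p; cases q) (simp add: algebra_simps)

lemma qcnj_qmul_self: "qmul (qcnj q) q = qreal (q \<bullet> q)" "qmul q (qcnj q) = qreal (q \<bullet> q)"
  by (cases q; simp add: qreal_def algebra_simps)+

lemma inner_qmul_left: "qmul g p \<bullet> qmul g q = (g \<bullet> g) * (p \<bullet> q)"
  by (cases p; cases q; cases g) (simp add: algebra_simps)

lemma S3_inner: "g \<in> S3 \<longleftrightarrow> g \<bullet> g = 1"
  by (simp add: S3_def norm_eq_1)

lemma S3_cancel:
  assumes "g \<in> S3"
  shows "qmul (qcnj g) (qmul g x) = x" "qmul g (qmul (qcnj g) x) = x"
proof -
  have "qmul (qreal 1) x = x" by simp
  then show "qmul (qcnj g) (qmul g x) = x" "qmul g (qmul (qcnj g) x) = x"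
    using assms by (metis qmul_assoc qcnj_qmul_self S3_inner)+
qed

lemma qre_qmul_cnj: "qre (qmul (qcnj g) X) = X \<bullet> g"
  by (cases g; cases X) (simp add: qre_def algebra_simps)

lemma tangent_iff:
  assumes "g \<in> S3"
  shows "tangent g X \<longleftrightarrow> (\<exists>x. X = qmul g (iq x))"
proof
  assume "tangent g X"
  then have "iq (vq (qmul (qcnj g) X)) = qmul (qcnj g) X"
    by (simp add: iq_vq qre_qmul_cnj tangent_def qreal_def zero_prod_def)
  then have "X = qmul g (iq (vq (qmul (qcnj g) X)))"
    using S3_cancel[OF assms] by simp
  then show "\<exists>x. X = qmul g (iq x)" ..
next
  assume "\<exists>x. X = qmul g (iq x)"
  then show "tangent g X"
    by (metis S3_cancel(1)[OF assms] qre_iq qre_qmul_cnj tangent_def)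
qed

section \<open>Calculus of left-invariant fields\<close>

text \<open>Derivative along the left-invariant field \<open>g \<mapsto> g x\<close>. The same
  formula is used off the sphere, so that \<open>L\<close> can be iterated on an open
  neighbourhood.\<close>

definition L :: "real^3 \<Rightarrow> (quat \<Rightarrow> 'a::real_normed_vector) \<Rightarrow> quat \<Rightarrow> 'a" where
  "L x F g = frechet_derivative F (at g) (qmul g (iq x))"

lemma L_has_derivative:
  "(F has_derivative F') (at g) \<Longrightarrow> L x F g = F' (qmul g (iq x))"
  unfolding L_def by (metis frechet_derivative_at)

lemma differentiable_works:
  "F differentiable (at g) \<Longrightarrow> (F has_derivative frechet_derivative F (at g)) (at g)"
  by (simp add: frechet_derivative_works[symmetric])

lemma L_linear:
  assumes "F differentiable (at g)"
  shows "linear (\<lambda>x. L x F g)"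
proof -
  have "linear (frechet_derivative F (at g) \<circ> (qmul g \<circ> iq))"
    by (intro linear_compose linear_iq linear_frechet_derivative assms
        bounded_linear.linear qmul.bounded_linear_right)
  then show ?thesis by (simp add: L_def o_def)
qed

lemma L_const [simp]: "L x (\<lambda>g. c) g = 0"
  by (simp add: L_def)

lemma L_add:
  assumes "F differentiable (at g)" "G differentiable (at g)"
  shows "L x (\<lambda>g. F g + G g) g = L x F g + L x G g"
  using L_has_derivative[OF has_derivative_add[OF assms[THEN differentiable_works]]]
  by (simp add: L_def)

lemma L_diff:
  assumes "F differentiable (at g)" "G differentiable (at g)"
  shows "L x (\<lambda>g. F g - G g) g = L x F g - L x G g"
  using L_has_derivative[OF has_derivative_diff[OF assms[THEN differentiable_works]]]
  by (simp add: L_def)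

lemma L_bilinear:
  assumes "bounded_bilinear pr" "F differentiable (at g)" "G differentiable (at g)"
  shows "L x (\<lambda>g. pr (F g) (G g)) g = pr (L x F g) (G g) + pr (F g) (L x G g)"
  using L_has_derivative[OF bounded_bilinear.FDERIV[OF assms(1) assms(2,3)[THEN differentiable_works]]]
  by (simp add: L_def add.commute)

lemma L_bounded_linear:
  assumes "bounded_linear T" "F differentiable (at g)"
  shows "L x (\<lambda>g. T (F g)) g = T (L x F g)"
  using L_has_derivative[OF bounded_linear.has_derivative[OF assms(1) assms(2)[THEN differentiable_works]]]
  by (simp add: L_def)

lemma L_cong_open:
  assumes "open U" "g \<in> U" "\<And>y. y \<in> U \<Longrightarrow> F y = G y" "F differentiable (at g)"
  shows "L x F g = L x G g"
  unfolding L_def using frechet_derivative_transform_within_open[OF assms(4,1,2,3)] by metis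

text \<open>Separates the moving direction \<open>g x\<close> from the derivatives of
  \<open>F\<close> in fixed directions: the coefficients are linear in \<open>g\<close>. Regularity
  of \<open>L x F\<close> and the iterated derivative are both read off from this form.\<close>

lemma L_basis_expansion:
  assumes "F differentiable (at g)"
  shows "L x F g = (\<Sum>b\<in>Basis. (qmul g (iq x) \<bullet> b) *\<^sub>R frechet_derivative F (at g) b)"
proof -
  have lin: "linear (frechet_derivative F (at g))" by (rule linear_frechet_derivative[OF assms])
  have "L x F g = frechet_derivative F (at g) (\<Sum>b\<in>Basis. (qmul g (iq x) \<bullet> b) *\<^sub>R b)"
    by (simp add: L_def euclidean_representation)
  also have "\<dots> = (\<Sum>b\<in>Basis. (qmul g (iq x) \<bullet> b) *\<^sub>R frechet_derivative F (at g) b)"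
    by (simp add: linear_sum[OF lin] linear_scale[OF lin])
  finally show ?thesis .
qed

lemma bounded_linear_qmul_component: "bounded_linear (\<lambda>g. qmul g p \<bullet> b)"
  using bounded_linear_compose[OF bounded_linear_inner_left qmul.bounded_linear_left] .

lemma Ck_L:
  assumes U: "open U" and F: "Ck (Suc n) U F"
  shows "Ck n U (L x F)"
proof (rule Ck_cong[OF U])
  fix g assume "g \<in> U"
  then have "F differentiable (at g)" using F by simp
  from L_basis_expansion[OF this]
  show "(\<Sum>b\<in>Basis. (qmul g (iq x) \<bullet> b) *\<^sub>R frechet_derivative F (at g) b) = L x F g" by simp
next
  have "Ck n U (\<lambda>g. frechet_derivative F (at g) b)" for b
    using F by (simp del: split_paired_All)
  then have "Ck n U (\<lambda>g. (qmul g (iq x) \<bullet> b) *\<^sub>R frechet_derivative F (at g) b)" for b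
    by (rule Ck_bilinear[OF bounded_bilinear_scaleR U Ck_linear[OF bounded_linear_qmul_component U]])
  then show "Ck n U (\<lambda>g. \<Sum>b\<in>Basis. (qmul g (iq x) \<bullet> b) *\<^sub>R frechet_derivative F (at g) b)"
    by (rule Ck_sum[OF U])
qed

text \<open>Product rule: the first term comes from differentiating the field
  \<open>p \<mapsto> p y\<close> in the direction \<open>g x\<close>, the second is the Euclidean
  Hessian of \<open>F\<close>.\<close>

lemma L_L:
  fixes F :: "quat \<Rightarrow> 'b::real_inner"
  assumes U: "open U" and F: "Ck (Suc (Suc 0)) U F" and g: "g \<in> U"
  shows "L x (L y F) g = frechet_derivative F (at g) (qmul (qmul g (iq x)) (iq y))
     + frechet_derivative (\<lambda>p. frechet_derivative F (at p) (qmul g (iq x))) (at g) (qmul g (iq y))"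
proof -
  define v where "v = qmul g (iq x)"
  have dF: "F differentiable (at p)" and dF2: "(\<lambda>p. frechet_derivative F (at p) a) differentiable (at p)"
    if "p \<in> U" for a p using F that by (auto simp del: split_paired_All)
  have lin: "linear (frechet_derivative F (at g))" by (rule linear_frechet_derivative[OF dF[OF g]])
  let ?D = "\<lambda>b. frechet_derivative (\<lambda>p. frechet_derivative F (at p) b) (at g)"
  let ?S = "\<lambda>p. \<Sum>b\<in>Basis. (qmul p (iq y) \<bullet> b) *\<^sub>R frechet_derivative F (at p) b"
  have S: "(?S has_derivative (\<lambda>v. \<Sum>b\<in>Basis. (qmul g (iq y) \<bullet> b) *\<^sub>R ?D b v
       + (qmul v (iq y) \<bullet> b) *\<^sub>R frechet_derivative F (at g) b)) (at g)"
    by (intro has_derivative_sum has_derivative_scaleR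
        bounded_linear.has_derivative[OF bounded_linear_qmul_component] has_derivative_ident
        differentiable_works dF2 g)
  have "L x (L y F) g = L x ?S g"
    by (rule L_cong_open[OF U g, symmetric])
       (use L_basis_expansion[OF dF] S in \<open>auto simp: differentiable_def\<close>)
  also have "\<dots> = (\<Sum>b\<in>Basis. (qmul g (iq y) \<bullet> b) *\<^sub>R ?D b v
       + (qmul v (iq y) \<bullet> b) *\<^sub>R frechet_derivative F (at g) b)"
    using L_has_derivative[OF S] by (simp add: v_def)
  also have "\<dots> = (\<Sum>b\<in>Basis. (qmul g (iq y) \<bullet> b) *\<^sub>R ?D v b)
       + frechet_derivative F (at g) (\<Sum>b\<in>Basis. (qmul v (iq y) \<bullet> b) *\<^sub>R b)"
    using symmetric_second_derivative[OF U g dF dF2]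
    by (simp add: sum.distrib linear_sum[OF lin] linear_scale[OF lin])
  also have "(\<Sum>b\<in>Basis. (qmul g (iq y) \<bullet> b) *\<^sub>R ?D v b) = ?D v (\<Sum>b\<in>Basis. (qmul g (iq y) \<bullet> b) *\<^sub>R b)"
    using linear_frechet_derivative[OF dF2[OF g]] by (simp add: linear_sum linear_scale)
  finally show ?thesis unfolding euclidean_representation v_def by simp
qed

text \<open>The Hessian terms of \<open>L_L\<close> cancel by symmetry; what remains is the
  quaternion commutator \<open>x y - y x = 2 (x \<times> y)\<close>.\<close>

lemma L_commutator:
  fixes F :: "quat \<Rightarrow> 'b::real_inner"
  assumes U: "open U" and F: "Ck (Suc (Suc 0)) U F" and g: "g \<in> U"
  shows "L x (L y F) g - L y (L x F) g = 2 *\<^sub>R L (cross3 x y) F g"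
proof -
  have dF: "F differentiable (at p)" and dF2: "(\<lambda>p. frechet_derivative F (at p) a) differentiable (at p)"
    if "p \<in> U" for a p using F that by (auto simp del: split_paired_All)
  have lin: "linear (frechet_derivative F (at g))" by (rule linear_frechet_derivative[OF dF[OF g]])
  have "qmul (qmul g (iq x)) (iq y) - qmul (qmul g (iq y)) (iq x) = 2 *\<^sub>R qmul g (iq (cross3 x y))"
  proof -
    have "qmul (qmul g (iq x)) (iq y) - qmul (qmul g (iq y)) (iq x)
      = qmul g (qmul (iq x) (iq y) - qmul (iq y) (iq x))"
      by (simp add: qmul_assoc qmul.diff_right)
    also have "qmul (iq x) (iq y) - qmul (iq y) (iq x) = 2 *\<^sub>R iq (cross3 x y)"
      using cross_skew[of y x] by (simp add: qmul_iq inner_commute iq_minus scaleR_2)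
    finally show ?thesis by (simp add: qmul.scaleR_right)
  qed
  then have "2 *\<^sub>R frechet_derivative F (at g) (qmul g (iq (cross3 x y)))
     = frechet_derivative F (at g) (qmul (qmul g (iq x)) (iq y))
       - frechet_derivative F (at g) (qmul (qmul g (iq y)) (iq x))"
    by (metis linear_diff[OF lin] linear_scale[OF lin])
  then show ?thesis
    unfolding L_L[OF U F g]
    using symmetric_second_derivative[OF U g dF dF2, of "qmul g (iq x)" "qmul g (iq y)"]
    by (simp add: L_def)
qed

section \<open>Great circles as integral curves\<close>

text \<open>For a unit vector \<open>v\<close> this is \<open>g exp(t v)\<close>, the integral curve
  through \<open>g\<close> of the left-invariant field of \<open>v\<close>.\<close>

definition great_circle :: "quat \<Rightarrow> real^3 \<Rightarrow> real \<Rightarrow> quat" where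
  "great_circle g v t = cos t *\<^sub>R g + sin t *\<^sub>R qmul g (iq v)"

lemma great_circle_S3:
  assumes "g \<in> S3" "norm v = 1"
  shows "great_circle g v t \<in> S3"
proof -
  have "great_circle g v t = qmul g (qreal (cos t) + sin t *\<^sub>R iq v)"
    by (simp add: great_circle_def qmul.add_right qmul.scaleR_right)
  moreover have "(qreal (cos t) + sin t *\<^sub>R iq v) \<bullet> (qreal (cos t) + sin t *\<^sub>R iq v) = 1"
  proof -
    have "v \<bullet> v = 1" using assms by (simp add: norm_eq_1)
    have "(qreal (cos t) + sin t *\<^sub>R iq v) \<bullet> (qreal (cos t) + sin t *\<^sub>R iq v)
       = cos t * cos t + sin t * sin t * (v \<bullet> v)"
      by (simp add: iq_def qreal_def inner_vec_def sum_3 algebra_simps)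
    then show ?thesis using \<open>v \<bullet> v = 1\<close> sin_cos_squared_add3[of t] by simp
  qed
  ultimately show ?thesis using assms(1) by (simp add: S3_inner inner_qmul_left)
qed

lemma great_circle_derivative:
  assumes "norm v = 1"
  shows "(great_circle g v has_vector_derivative qmul (great_circle g v t) (iq v)) (at t)"
proof -
  have "qmul (iq v) (iq v) = qreal (-1)"
    using assms by (simp add: qmul_iq norm_eq_1) (simp add: qreal_def iq_def zero_prod_def)
  then have "qmul (great_circle g v t) (iq v) = (- sin t) *\<^sub>R g + cos t *\<^sub>R qmul g (iq v)"
    by (simp add: great_circle_def qmul.add_left qmul.scaleR_left qmul_assoc)
  moreover have "(great_circle g v has_vector_derivative ((- sin t) *\<^sub>R g + cos t *\<^sub>R qmul g (iq v))) (at t)"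
    unfolding great_circle_def has_vector_derivative_def
    by (auto intro!: derivative_eq_intros simp: algebra_simps)
  ultimately show ?thesis by simp
qed

lemma L_great_circle:
  assumes "norm v = 1" "F differentiable (at (great_circle g v t))"
  shows "((\<lambda>t. F (great_circle g v t)) has_vector_derivative L v F (great_circle g v t)) (at t)"
  using vector_derivative_diff_chain_within[of "great_circle g v" "qmul (great_circle g v t) (iq v)" t UNIV F
      "frechet_derivative F (at (great_circle g v t))"]
    great_circle_derivative[OF assms(1)] differentiable_works[OF assms(2)]
  by (simp add: L_def o_def has_derivative_at_withinI)

lemma great_circle_0 [simp]: "great_circle g v 0 = g"
  by (simp add: great_circle_def)

text \<open>The great circle through \<open>g\<close> stays in the sphere, so the derivative sees
  only values there. Thus identities known only on \<open>S3\<close> can be differentiated, whatever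
  the ambient extensions.\<close>

lemma L_eq_on_S3:
  assumes g: "g \<in> S3" and eq: "\<And>p. p \<in> S3 \<Longrightarrow> F p = G p"
    and d: "F differentiable (at g)" "G differentiable (at g)"
  shows "L x F g = L x G g"
proof -
  have unit: "L v F g = L v G g" if v: "norm v = 1" for v
  proof -
    have "((\<lambda>t. F (great_circle g v t)) has_vector_derivative L v F g) (at 0)"
      "((\<lambda>t. G (great_circle g v t)) has_vector_derivative L v G g) (at 0)"
      using L_great_circle[OF v, of _ g 0] d by simp_all
    moreover have "(\<lambda>t. F (great_circle g v t)) = (\<lambda>t. G (great_circle g v t))"
      using eq great_circle_S3[OF g v] by auto
    ultimately show ?thesis using vector_derivative_unique_at by metis
  qed
  show ?thesis
  proof (cases "x = 0")
    case True
    then show ?thesis using linear_0[OF L_linear[OF d(1)]] linear_0[OF L_linear[OF d(2)]] by simp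
  next
    case False
    define y where "y = x /\<^sub>R norm x"
    have y: "x = norm x *\<^sub>R y" "norm y = 1" using False by (auto simp: y_def)
    have "L (norm x *\<^sub>R y) F g = norm x *\<^sub>R L y F g" "L (norm x *\<^sub>R y) G g = norm x *\<^sub>R L y G g"
      using linear_scale[OF L_linear[OF d(1)]] linear_scale[OF L_linear[OF d(2)]] by blast+
    then show ?thesis using unit[OF y(2)] y(1) by simp
  qed
qed

lemma great_circle_from_1:
  assumes "q \<in> S3"
  obtains v t where "norm v = 1" "q = great_circle (qreal 1) v t"
proof -
  obtain a x where q: "q = qreal a + iq x"
    using iq_vq[of q] by (metis add.commute diff_add_cancel)
  have "a\<^sup>2 + (norm x)\<^sup>2 = 1"
    using assms unfolding S3_inner q power2_norm_eq_inner
    by (simp add: qreal_def iq_def inner_vec_def sum_3 power2_eq_square algebra_simps)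
  then obtain t where t: "a = cos t" "norm x = sin t"
    using sincos_total_2pi_le by metis
  show thesis
  proof (cases "x = 0")
    case True
    \<comment> \<open>Here \<open>sin t = 0\<close>, so any unit vector serves as direction.\<close>
    then show thesis using that[of "axis 1 1" t] t q
      by (simp add: great_circle_def iq_def qreal_def zero_prod_def)
  next
    case False
    have "sin t *\<^sub>R iq (x /\<^sub>R norm x) = iq x"
      using False unfolding t(2)[symmetric] iq_scale by simp
    moreover have "cos t *\<^sub>R qreal 1 = qreal a" using t by (simp add: qreal_def)
    ultimately have "q = great_circle (qreal 1) (x /\<^sub>R norm x) t"
      unfolding great_circle_def qmul_real_left q by simp
    then show thesis using that[of "x /\<^sub>R norm x" t] False by simp
  qed
qed

text \<open>Every point of the sphere lies on a great circle through 1, along which \<open>F\<close>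
  has zero derivative.\<close>

lemma constant_on_S3:
  fixes F :: "quat \<Rightarrow> 'a::real_normed_vector"
  assumes d: "\<And>g. g \<in> S3 \<Longrightarrow> F differentiable (at g)"
    and L0: "\<And>g x. g \<in> S3 \<Longrightarrow> L x F g = 0" and q: "q \<in> S3"
  shows "F q = F (qreal 1)"
proof -
  obtain v t where v: "norm v = 1" "q = great_circle (qreal 1) v t"
    using great_circle_from_1[OF q] .
  have one: "qreal 1 \<in> S3" by (simp add: S3_inner qreal_def)
  have "((\<lambda>t. F (great_circle (qreal 1) v t)) has_vector_derivative 0) (at s within UNIV)" for s
    using L_great_circle[OF v(1) d[OF great_circle_S3[OF one v(1)]]] L0[OF great_circle_S3[OF one v(1)]]
    by metis
  then obtain c where "\<And>s. F (great_circle (qreal 1) v s) = c"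
    using has_vector_derivative_zero_constant[of UNIV "\<lambda>t. F (great_circle (qreal 1) v t)"] by auto
  then show ?thesis using v(2) by (metis great_circle_0)
qed

section \<open>Second derivative test on the sphere\<close>

lemma second_derivative_at_max:
  fixes \<phi> :: "real \<Rightarrow> real"
  assumes d1: "\<And>t. (\<phi> has_real_derivative \<phi>' t) (at t)"
    and d2: "(\<phi>' has_real_derivative D) (at 0)"
    and max: "\<And>t. \<phi> t \<le> \<phi> 0"
  shows "\<phi>' 0 = 0" "D \<le> 0"
proof -
  show z: "\<phi>' 0 = 0"
    using DERIV_local_max[OF d1[of 0], of 1] max by auto
  show "D \<le> 0"
  proof (rule ccontr)
    assume "\<not> D \<le> 0"
    then obtain d where d: "d > 0" "\<And>h. h > 0 \<Longrightarrow> h < d \<Longrightarrow> \<phi>' 0 < \<phi>' (0 + h)"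
      using DERIV_pos_inc_right[OF d2] by auto
    obtain z where "0 < z" "z < d/2" "\<phi> (d/2) - \<phi> 0 = (d/2 - 0) * \<phi>' z"
      using MVT2[of 0 "d/2" \<phi> \<phi>'] d1 d(1) by auto
    moreover have "\<phi>' z > 0" using d(2)[of z] \<open>0 < z\<close> \<open>z < d/2\<close> z d(1) by auto
    moreover from this have "(d/2 - 0) * \<phi>' z > 0" using d(1) by simp
    ultimately have "\<phi> (d/2) > \<phi> 0" by linarith
    then show False using max[of "d/2"] by simp
  qed
qed

lemma L_at_max:
  fixes F :: "quat \<Rightarrow> real"
  assumes U: "open U" "S3 \<subseteq> U" and F: "Ck (Suc (Suc 0)) U F" and g: "g \<in> S3"
    and max: "\<And>p. p \<in> S3 \<Longrightarrow> F p \<le> F g" and v: "norm v = 1"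
  shows "L v F g = 0" "L v (L v F) g \<le> 0"
proof -
  let ?c = "great_circle g v"
  have c: "?c t \<in> S3" for t by (rule great_circle_S3[OF g v])
  have d1: "((\<lambda>t. F (?c t)) has_real_derivative L v F (?c t)) (at t)" for t
    using L_great_circle[OF v, of F g t] F c[of t] U
    by (auto simp: has_real_derivative_iff_has_vector_derivative)
  have "Ck (Suc 0) U (L v F)" by (rule Ck_L[OF U(1) F])
  then have d2: "((\<lambda>t. L v F (?c t)) has_real_derivative L v (L v F) (?c 0)) (at 0)"
    using L_great_circle[OF v, of "L v F" g 0] c[of 0] U
    by (auto simp: has_real_derivative_iff_has_vector_derivative)
  have m: "F (?c t) \<le> F (?c 0)" for t using max c by simp
  from second_derivative_at_max[OF d1 d2 m] show "L v F g = 0" "L v (L v F) g \<le> 0" by simp_all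
qed

subsection \<open>Orthonormal frames\<close>

definition frame :: "real^3 \<Rightarrow> real^3 \<Rightarrow> real^3 \<Rightarrow> bool" where
  "frame u v w \<longleftrightarrow> u \<bullet> u = 1 \<and> v \<bullet> v = 1 \<and> u \<bullet> v = 0 \<and> w = cross3 u v"

lemma frame_simps:
  assumes "frame u v w"
  shows "u \<bullet> u = 1" "v \<bullet> v = 1" "w \<bullet> w = 1" "u \<bullet> v = 0" "v \<bullet> u = 0" "u \<bullet> w = 0" "w \<bullet> u = 0"
    "v \<bullet> w = 0" "w \<bullet> v = 0" "cross3 u v = w" "cross3 v u = - w" "cross3 v w = u" "cross3 w v = - u"
    "cross3 w u = v" "cross3 u w = - v"
  using assms cross_skew[of v u] cross_skew[of w u] cross_skew[of w v]
  by (auto simp: frame_def dot_cross dot_cross_self inner_commute Lagrange)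

lemma frame_expansion:
  assumes f: "frame u v w"
  shows "x = (x \<bullet> u) *\<^sub>R u + (x \<bullet> v) *\<^sub>R v + (x \<bullet> w) *\<^sub>R w"
proof -
  note fs = frame_simps[OF f]
  define y where "y = x - ((x \<bullet> u) *\<^sub>R u + (x \<bullet> v) *\<^sub>R v + (x \<bullet> w) *\<^sub>R w)"
  have y: "y \<bullet> u = 0" "y \<bullet> v = 0" "y \<bullet> w = 0"
    by (simp_all add: y_def inner_diff_left inner_add_left fs)
  \<comment> \<open>The remainder \<open>y\<close> is orthogonal to \<open>u\<close> and
    \<open>v\<close>, hence parallel to \<open>w\<close>; being orthogonal to \<open>w\<close> as
    well, it vanishes.\<close>
  have "cross3 y (cross3 u v) = 0" by (simp only: Lagrange y) simp
  then have "cross3 w y = 0" using fs(10) cross_skew[of w y] by simp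
  moreover have "w \<noteq> 0" using fs(3) by auto
  ultimately have "y = 0" using cross_dot_cancel[of w y 0] y by (simp add: inner_commute)
  then show ?thesis by (simp add: y_def)
qed

text \<open>Expanding the argument of \<open>T\<close> in one frame and the other factor in the
  other frame turns both traces into the same double sum.\<close>

lemma frame_trace:
  assumes f: "frame u v w" and f': "frame u' v' w'" and T: "linear T"
  shows "T u \<bullet> u + T v \<bullet> v + T w \<bullet> w = T u' \<bullet> u' + T v' \<bullet> v' + T w' \<bullet> w'"
proof -
  have 1: "T x \<bullet> x = (x \<bullet> u') * (T u' \<bullet> x) + (x \<bullet> v') * (T v' \<bullet> x) + (x \<bullet> w') * (T w' \<bullet> x)" for x
  proof -
    have "T x = (x \<bullet> u') *\<^sub>R T u' + (x \<bullet> v') *\<^sub>R T v' + (x \<bullet> w') *\<^sub>R T w'"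
      by (subst frame_expansion[OF f', of x]) (simp add: linear_add[OF T] linear_scale[OF T])
    then show ?thesis by (simp add: inner_add_left)
  qed
  have 2: "T y \<bullet> y = (y \<bullet> u) * (T y \<bullet> u) + (y \<bullet> v) * (T y \<bullet> v) + (y \<bullet> w) * (T y \<bullet> w)" for y
    using arg_cong[OF frame_expansion[OF f, of y], of "\<lambda>z. T y \<bullet> z"]
    by (simp add: inner_add_right)
  show ?thesis
    unfolding 1[of u] 1[of v] 1[of w] 2[of u'] 2[of v'] 2[of w']
    by (simp add: inner_commute)
qed

lemma frame_axis: "frame (axis 1 1) (axis 2 1) (axis 3 1)"
  by (simp add: frame_def cross_basis inner_axis_axis)

text \<open>By symmetry \<open>T\<close> preserves the plane orthogonal to \<open>w\<close>. Any
  orthonormal basis of it is rotated by half the polar angle of (half the difference of the diagonal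
  entries, off-diagonal entry), which kills the off-diagonal entry.\<close>

lemma diagonalizing_frame:
  fixes T :: "real^3 \<Rightarrow> real^3"
  assumes T: "linear T" and sym: "\<And>x y. T x \<bullet> y = T y \<bullet> x" and w: "w \<bullet> w = 1" and Tw: "T w = 0"
  obtains u v l m where "frame u v w" "T u = l *\<^sub>R u" "T v = m *\<^sub>R v"
proof -
  obtain y :: "real^3" where y: "y \<noteq> 0" "orthogonal w y"
    using orthogonal_to_vector_exists[of w] by auto
  define u0 where "u0 = y /\<^sub>R norm y"
  have "norm u0 = 1" using y by (simp add: u0_def)
  then have "u0 \<bullet> u0 = 1" by (simp only: norm_eq_1)
  moreover have "w \<bullet> u0 = 0" using y by (simp add: u0_def orthogonal_def)
  ultimately have u0: "u0 \<bullet> u0 = 1" "w \<bullet> u0 = 0" .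
  define v0 where "v0 = cross3 w u0"
  have fr0: "frame u0 v0 w"
    using u0 w by (simp add: frame_def v0_def dot_cross dot_cross_self Lagrange inner_commute)
  note fs = frame_simps[OF fr0]
  obtain R \<phi> where R: "(T u0 \<bullet> u0 - T v0 \<bullet> v0) / 2 = R * cos \<phi>" "T u0 \<bullet> v0 = R * sin \<phi>"
    using polar_Ex by blast
  define c where "c = cos (\<phi>/2)"
  define s where "s = sin (\<phi>/2)"
  have cs: "c * c + s * s = 1" "cos \<phi> = c * c - s * s" "sin \<phi> = 2 * s * c"
    using cos_double[of "\<phi>/2"] sin_double[of "\<phi>/2"]
    by (auto simp: c_def s_def power2_eq_square)
  define u where "u = c *\<^sub>R u0 + s *\<^sub>R v0"
  define v where "v = c *\<^sub>R v0 - s *\<^sub>R u0"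
  have fr: "frame u v w"
  proof -
    have "cross3 u v = (c * c + s * s) *\<^sub>R w"
      by (simp add: u_def v_def cr.add_left cr.diff_right cr.add_right cr.scaleR_left cr.scaleR_right fs algebra_simps)
    moreover have "u \<bullet> u = c * c + s * s" "v \<bullet> v = c * c + s * s" "u \<bullet> v = 0"
      by (simp_all add: u_def v_def inner_add_left inner_add_right inner_diff_left inner_diff_right fs)
    ultimately show ?thesis using cs by (simp add: frame_def)
  qed
  have "T u \<bullet> v = (c * c - s * s) * (T u0 \<bullet> v0) - s * c * (T u0 \<bullet> u0 - T v0 \<bullet> v0)"
    using sym[of v0 u0]
    by (simp add: u_def v_def linear_add[OF T] linear_scale[OF T] inner_add_left inner_diff_right algebra_simps)
  moreover have "T u0 \<bullet> u0 - T v0 \<bullet> v0 = 2 * R * cos \<phi>" using R(1) by simp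
  ultimately have uv: "T u \<bullet> v = 0" using R(2) by (simp add: cs)
  have Tx: "T x \<bullet> w = 0" for x using sym[of x w] Tw by simp
  have "T u = (T u \<bullet> u) *\<^sub>R u" "T v = (T v \<bullet> v) *\<^sub>R v"
    using frame_expansion[OF fr, of "T u"] frame_expansion[OF fr, of "T v"] uv sym[of v u] Tx by auto
  then show thesis using that fr by blast
qed

text \<open>On the plane orthogonal to \<open>h\<close>, the map
  \<open>a \<mapsto> c a + a \<times> h\<close> is a rotation because
  \<open>c\<^sup>2 + h \<bullet> h = 1\<close>, and rotations of a plane preserve the cross product
  of its vectors.\<close>

lemma cross_rotate_orthogonal:
  fixes a b h :: "real^3"
  assumes "a \<bullet> h = 0" "b \<bullet> h = 0" "c\<^sup>2 + h \<bullet> h = 1"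
  shows "cross3 (c *\<^sub>R a + cross3 a h) (c *\<^sub>R b + cross3 b h) = cross3 a b"
proof -
  have "cross3 (c *\<^sub>R a + cross3 a h) (c *\<^sub>R b + cross3 b h)
     = c\<^sup>2 *\<^sub>R cross3 a b + c *\<^sub>R (cross3 a (cross3 b h) - cross3 b (cross3 a h)) + cross3 (cross3 a h) (cross3 b h)"
    using cross_skew[of "cross3 a h" b]
    by (simp add: cr.add_left cr.add_right cr.scaleR_left cr.scaleR_right algebra_simps power2_eq_square)
  also have "cross3 a (cross3 b h) - cross3 b (cross3 a h) = 0"
    using assms by (simp add: Lagrange inner_commute)
  also have "cross3 (cross3 a h) (cross3 b h) = (h \<bullet> h) *\<^sub>R cross3 a b"
  proof -
    have "cross3 h (cross3 a b) = 0" using assms by (simp add: Lagrange inner_commute)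
    then have "(h \<bullet> h) *\<^sub>R cross3 a b = (h \<bullet> cross3 a b) *\<^sub>R h"
      using Lagrange[of h h "cross3 a b"] by simp
    moreover have "h \<bullet> cross3 a b = - (cross3 a h \<bullet> b)"
      using cross_triple[of a b h] cross_triple[of b h a] cross_skew[of h a]
      by (simp add: inner_commute)
    ultimately show ?thesis by (simp add: Lagrange dot_cross_self)
  qed
  finally show ?thesis using assms(3) by (simp add: scaleR_left_distrib[symmetric])
qed

lemma Ck_differentiable: "Ck (Suc n) U F \<Longrightarrow> g \<in> U \<Longrightarrow> F differentiable (at g)"
  by simp

lemma inner_sq_le:
  fixes x w :: "real^3"
  assumes "w \<bullet> w = 1"
  shows "(x \<bullet> w)\<^sup>2 \<le> x \<bullet> x"
  using Cauchy_Schwarz_ineq[of x w] assms by simp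

text \<open>The two factors have the same sign, and the sum decides which. They are the weights of
  the second derivatives of the trace in \<open>critical_inequality\<close>, whose signs drive the
  maximum principle.\<close>

lemma sum_product_pos:
  fixes l m :: real
  assumes "(1 + l) * (1 + m) = 1" "l + m > 0"
  shows "1 + l > 0" "1 + m > 0"
proof -
  have *: "1 + x > 0" if "(1 + x) * (1 + y) = 1" "x + y > 0" for x y :: real
  proof (rule ccontr)
    assume n: "\<not> 1 + x > 0"
    then have "1 + x < 0" using that by (cases "1 + x = 0") auto
    then have "1 + y < 0" using that(1) zero_less_mult_iff[of "1 + x" "1 + y"] by auto
    then show False using n that by simp
  qed
  show "1 + l > 0" "1 + m > 0" using *[of l m] *[of m l] assms by (auto simp: mult.commute add.commute)
qed

lemma sum_product_neg:
  fixes l m :: real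
  assumes "(1 + l) * (1 + m) = 1" "l + m < - 4"
  shows "1 + l < 0" "1 + m < 0"
proof -
  have *: "1 + x < 0" if "(1 + x) * (1 + y) = 1" "x + y < -4" for x y :: real
  proof (rule ccontr)
    assume n: "\<not> 1 + x < 0"
    then have "1 + x > 0" using that by (cases "1 + x = 0") auto
    then have "1 + y > 0" using that(1) by (metis zero_less_mult_pos zero_less_one)
    then show False using n that by simp
  qed
  show "1 + l < 0" "1 + m < 0" using *[of l m] *[of m l] assms by (auto simp: mult.commute add.commute)
qed

lemma compact_S3: "compact S3" and S3_nonempty: "S3 \<noteq> {}"
  by (auto simp: S3_def)

lemma L_eq_0_from_unit:
  assumes d: "F differentiable (at g)" and u: "\<And>v. norm v = 1 \<Longrightarrow> L v F g = 0"
  shows "L x F g = 0"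
proof -
  note lin = L_linear[OF d]
  show ?thesis
    by (subst frame_expansion[OF frame_axis, of x])
       (simp add: linear_add[OF lin] linear_scale[OF lin] u)
qed

subsection \<open>The structure tensor of a generalized Killing spinor\<close>

text \<open>The formula for \<open>b\<close> inverts \<open>L x h = c b(x) + b(x) \<times> h\<close>
  on the plane orthogonal to \<open>h\<close>. It makes \<open>b\<close> smooth on all of
  \<open>U\<close>, whereas \<open>gen_killing\<close> supplies an endomorphism only pointwise on
  \<open>S3\<close>.\<close>

locale killing_tensor =
  fixes U :: "quat set" and h :: "quat \<Rightarrow> real^3" and c :: real
    and b :: "real^3 \<Rightarrow> quat \<Rightarrow> real^3"
  assumes U: "open U" "S3 \<subseteq> U"
    and h_smooth: "\<And>n. Ck n U h"
    and unit: "\<And>g. g \<in> S3 \<Longrightarrow> c\<^sup>2 + h g \<bullet> h g = 1"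
    and b_def: "b = (\<lambda>x g. c *\<^sub>R L x h g - cross3 (L x h g) (h g))"
    and b_sym: "\<And>g x y. g \<in> S3 \<Longrightarrow> b x g \<bullet> y = b y g \<bullet> x"
begin

lemma Lh_smooth: "Ck n U (L x h)" by (rule Ck_L[OF U(1) h_smooth])

lemma b_smooth: "Ck n U (b x)"
  unfolding b_def
  by (intro Ck_diff U Ck_bounded_linear[OF bounded_linear_scaleR_right]
      Ck_bilinear[OF bounded_bilinear_cross3] Lh_smooth h_smooth)

lemma Lb_smooth: "Ck n U (L y (b x))" by (rule Ck_L[OF U(1) b_smooth])

lemma differentiable_S3:
  assumes "g \<in> S3"
  shows "h differentiable (at g)" "L x h differentiable (at g)" "L x (L y h) differentiable (at g)" "b x differentiable (at g)"
    "L y (b x) differentiable (at g)" "L z (L y (b x)) differentiable (at g)"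
  using assms U Ck_differentiable[OF h_smooth] Ck_differentiable[OF Lh_smooth] Ck_differentiable[OF b_smooth]
    Ck_differentiable[OF Lb_smooth] Ck_differentiable[OF Ck_L[OF U(1) Lb_smooth]]
    Ck_differentiable[OF Ck_L[OF U(1) Lh_smooth]] by (meson subsetD)+

lemma Lh_orth:
  assumes g: "g \<in> S3"
  shows "L x h g \<bullet> h g = 0"
proof -
  have "L x (\<lambda>g. h g \<bullet> h g) g = L x (\<lambda>g. 1 - c\<^sup>2) g"
    using unit by (intro L_eq_on_S3[OF g]) (auto simp: algebra_simps intro: differentiable_inner differentiable_S3[OF g])
  then have "2 * (L x h g \<bullet> h g) = 0"
    by (simp add: L_bilinear[OF bounded_bilinear_inner differentiable_S3(1)[OF g] differentiable_S3(1)[OF g]] inner_commute)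
  then show ?thesis by simp
qed

lemma b_orth:
  assumes g: "g \<in> S3"
  shows "b x g \<bullet> h g = 0"
  using Lh_orth[OF g] by (simp add: b_def inner_diff_left dot_cross_self)

lemma Lh_eq:
  assumes g: "g \<in> S3"
  shows "L x h g = c *\<^sub>R b x g + cross3 (b x g) (h g)"
proof -
  let ?p = "L x h g"
  have "cross3 (cross3 ?p (h g)) (h g) = - ((h g \<bullet> h g) *\<^sub>R ?p)"
    using Lh_orth[OF g, of x] cross_skew[of "cross3 ?p (h g)" "h g"] by (simp add: Lagrange inner_commute)
  then have "c *\<^sub>R b x g + cross3 (b x g) (h g) = (c\<^sup>2 + h g \<bullet> h g) *\<^sub>R ?p"
    by (simp add: b_def cr.diff_left cr.scaleR_left algebra_simps power2_eq_square)
  then show ?thesis using unit[OF g] by simp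
qed

lemma b_linear:
  assumes g: "g \<in> S3"
  shows "linear (\<lambda>x. b x g)"
proof (rule linearI)
  note lin = L_linear[OF differentiable_S3(1)[OF g]]
  show "b (x + y) g = b x g + b y g" for x y
    by (simp add: b_def linear_add[OF lin] cr.add_left scaleR_add_right)
  show "b (r *\<^sub>R x) g = r *\<^sub>R b x g" for r x
    by (simp add: b_def linear_scale[OF lin] cr.scaleR_left scaleR_diff_right mult.commute)
qed

text \<open>The image of \<open>b\<close> is orthogonal to \<open>h\<close>, so by symmetry
  \<open>h\<close> lies in the kernel.\<close>

lemma b_kernel:
  assumes g: "g \<in> S3"
  shows "b (h g) g = 0"
proof -
  have "b (h g) g \<bullet> y = 0" for y using b_sym[OF g] b_orth[OF g] by metis
  then show ?thesis by (metis inner_eq_zero_iff)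
qed

text \<open>Antisymmetrizing the derivative of the formula for \<open>b\<close>, second derivatives
  of \<open>h\<close> enter only through their commutator, which gives
  \<open>2 b(x \<times> y)\<close>. The product terms give \<open>2 (L x h \<times> L y h)\<close>,
  and \<open>L x h\<close> is \<open>b(x)\<close> up to a rotation common to all
  \<open>x\<close>.\<close>

lemma b_codazzi:
  assumes g: "g \<in> S3"
  shows "L x (b y) g - L y (b x) g = 2 *\<^sub>R b (cross3 x y) g + 2 *\<^sub>R cross3 (b x g) (b y g)"
proof -
  have Lb: "L x (b y) g = c *\<^sub>R L x (L y h) g - cross3 (L x (L y h) g) (h g) - cross3 (L y h g) (L x h g)" for x y
  proof -
    have "L x (b y) g = L x (\<lambda>g. c *\<^sub>R L y h g) g - L x (\<lambda>g. cross3 (L y h g) (h g)) g"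
      unfolding b_def
      by (intro L_diff Ck_differentiable[of 0, OF Ck_bounded_linear[OF bounded_linear_scaleR_right U(1) Lh_smooth]]
          Ck_differentiable[of 0, OF Ck_bilinear[OF bounded_bilinear_cross3 U(1) Lh_smooth h_smooth]])
        (use g U in auto)
    then show ?thesis
      by (simp add: L_bilinear[OF bounded_bilinear_cross3 differentiable_S3(2)[OF g] differentiable_S3(1)[OF g]]
          L_bounded_linear[OF bounded_linear_scaleR_right differentiable_S3(2)[OF g]])
  qed
  have com: "L x (L y h) g = L y (L x h) g + 2 *\<^sub>R L (cross3 x y) h g"
    using L_commutator[OF U(1) h_smooth, of g x y] g U by (auto simp: algebra_simps)
  have "L x (b y) g - L y (b x) g = 2 *\<^sub>R b (cross3 x y) g + 2 *\<^sub>R cross3 (L x h g) (L y h g)"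
  proof -
    let ?M = "L (cross3 x y) h g"
    have "L x (b y) g - L y (b x) g
       = 2 *\<^sub>R (c *\<^sub>R ?M - cross3 ?M (h g)) + (cross3 (L x h g) (L y h g) - cross3 (L y h g) (L x h g))"
      unfolding Lb com by (simp add: cr.add_left cr.scaleR_left scaleR_add_right scaleR_diff_right mult.commute)
    also have "cross3 (L x h g) (L y h g) - cross3 (L y h g) (L x h g) = 2 *\<^sub>R cross3 (L x h g) (L y h g)"
      using cross_skew[of "L y h g" "L x h g"] by (simp add: scaleR_2)
    finally show ?thesis by (simp only: b_def)
  qed
  also have "cross3 (L x h g) (L y h g) = cross3 (b x g) (b y g)"
    unfolding Lh_eq[OF g]
    using cross_rotate_orthogonal[OF b_orth[OF g] b_orth[OF g] unit[OF g]] .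
  finally show ?thesis .
qed

lemma Lb_sym:
  assumes g: "g \<in> S3"
  shows "L z (b x) g \<bullet> y = L z (b y) g \<bullet> x"
proof -
  have "L z (\<lambda>g. b x g \<bullet> y) g = L z (\<lambda>g. b y g \<bullet> x) g"
    by (intro L_eq_on_S3[OF g] b_sym) (auto intro: differentiable_inner differentiable_S3[OF g])
  then show ?thesis
    by (simp add: L_bounded_linear[OF bounded_linear_inner_left differentiable_S3(4)[OF g]])
qed

lemma Lb_h:
  assumes g: "g \<in> S3"
  shows "L z (b x) g \<bullet> h g = - (b x g \<bullet> L z h g)"
proof -
  have "L z (\<lambda>g. b x g \<bullet> h g) g = L z (\<lambda>g. 0) g"
    by (intro L_eq_on_S3[OF g] b_orth) (auto intro: differentiable_inner differentiable_S3[OF g])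
  then show ?thesis
    by (simp add: L_bilinear[OF bounded_bilinear_inner differentiable_S3(4)[OF g] differentiable_S3(1)[OF g]])
qed

section \<open>Trace and squared norm of the structure tensor\<close>

definition tau :: "quat \<Rightarrow> real" where
  "tau g = b (axis 1 1) g \<bullet> axis 1 1 + b (axis 2 1) g \<bullet> axis 2 1 + b (axis 3 1) g \<bullet> axis 3 1"

definition nu :: "quat \<Rightarrow> real" where
  "nu g = b (axis 1 1) g \<bullet> b (axis 1 1) g + b (axis 2 1) g \<bullet> b (axis 2 1) g + b (axis 3 1) g \<bullet> b (axis 3 1) g"

lemma tau_frame:
  assumes g: "g \<in> S3" and f: "frame u v w"
  shows "tau g = b u g \<bullet> u + b v g \<bullet> v + b w g \<bullet> w"
  unfolding tau_def by (rule frame_trace[OF frame_axis f b_linear[OF g]])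

lemma nu_frame:
  assumes g: "g \<in> S3" and f: "frame u v w"
  shows "nu g = b u g \<bullet> b u g + b v g \<bullet> b v g + b w g \<bullet> b w g"
proof -
  have *: "b x g \<bullet> b x g = b (b x g) g \<bullet> x" for x by (rule b_sym[OF g])
  have "linear ((\<lambda>x. b x g) \<circ> (\<lambda>x. b x g))" by (intro linear_compose b_linear g)
  from frame_trace[OF frame_axis f this] show ?thesis unfolding nu_def * by simp
qed

lemma tau_smooth: "Ck n U tau"
  unfolding tau_def
  by (intro Ck_add U Ck_bounded_linear[OF bounded_linear_inner_left] b_smooth)

lemma nu_smooth: "Ck n U nu"
  unfolding nu_def
  by (intro Ck_add U Ck_bilinear[OF bounded_bilinear_inner] b_smooth)

lemma differentiable_tau_nu_S3:
  assumes "g \<in> S3"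
  shows "tau differentiable (at g)" "L x tau differentiable (at g)" "nu differentiable (at g)" "L x nu differentiable (at g)"
  using assms U Ck_differentiable[OF tau_smooth] Ck_differentiable[OF Ck_L[OF U(1) tau_smooth]]
    Ck_differentiable[OF nu_smooth] Ck_differentiable[OF Ck_L[OF U(1) nu_smooth]] by (meson subsetD)+

text \<open>The vectors \<open>u\<close>, \<open>v\<close>, \<open>w\<close> are constant in the
  left-invariant trivialization, so differentiation produces no derivatives of the frame.\<close>

lemma L_tau:
  assumes g: "g \<in> S3" and f: "frame u v w"
  shows "L x tau g = L x (b u) g \<bullet> u + L x (b v) g \<bullet> v + L x (b w) g \<bullet> w"
proof -
  have "L x tau g = L x (\<lambda>g. b u g \<bullet> u + b v g \<bullet> v + b w g \<bullet> w) g"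
    by (intro L_eq_on_S3[OF g] tau_frame[OF _ f] differentiable_tau_nu_S3[OF g] differentiable_add differentiable_inner differentiable_S3[OF g])
       auto
  also have "\<dots> = L x (b u) g \<bullet> u + L x (b v) g \<bullet> v + L x (b w) g \<bullet> w"
    by (simp add: L_add L_bounded_linear[OF bounded_linear_inner_left] differentiable_S3[OF g] differentiable_add differentiable_inner)
  finally show ?thesis .
qed

lemma L_nu:
  assumes g: "g \<in> S3" and f: "frame u v w"
  shows "L x nu g = 2 * (L x (b u) g \<bullet> b u g + L x (b v) g \<bullet> b v g + L x (b w) g \<bullet> b w g)"
proof -
  have "L x nu g = L x (\<lambda>g. b u g \<bullet> b u g + b v g \<bullet> b v g + b w g \<bullet> b w g) g"
    by (intro L_eq_on_S3[OF g] nu_frame[OF _ f] differentiable_tau_nu_S3[OF g] differentiable_add differentiable_inner differentiable_S3[OF g])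
       auto
  also have "\<dots> = 2 * (L x (b u) g \<bullet> b u g + L x (b v) g \<bullet> b v g + L x (b w) g \<bullet> b w g)"
    by (simp add: L_add L_bilinear[OF bounded_bilinear_inner] differentiable_S3[OF g] differentiable_add differentiable_inner inner_commute)
  finally show ?thesis .
qed

text \<open>Diagonalize \<open>b\<close> at the single point \<open>g\<close>, with \<open>w\<close>
  along \<open>h\<close>. Components along \<open>w\<close> of the derivatives of \<open>b\<close>
  come from differentiating \<open>b(x) \<bullet> h = 0\<close>, and Codazzi converts them into
  derivatives along \<open>w\<close>. The entry \<open>L w (b u) g \<bullet> v\<close> is thereby
  \<open>l * m + 2 * m\<close>, and its transpose \<open>- (l * m) - 2 * l\<close>; symmetry of
  \<open>b\<close> gives the relation between the eigenvalues.\<close>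

lemma adapted_frame:
  assumes g: "g \<in> S3" and h0: "h g \<noteq> 0"
  obtains u v w l m where "frame u v w" "h g = norm (h g) *\<^sub>R w" "b u g = l *\<^sub>R u" "b v g = m *\<^sub>R v" "b w g = 0"
    "l * m = - (l + m)" "tau g = l + m" "nu g = (tau g)\<^sup>2 + 2 * tau g"
    "norm (h g) * (L w (b u) g \<bullet> u) = - (c * l\<^sup>2)" "norm (h g) * (L w (b v) g \<bullet> v) = - (c * m\<^sup>2)"
    "L w (b w) g \<bullet> w = 0"
proof -
  define r where "r = norm (h g)"
  define w where "w = h g /\<^sub>R r"
  have r: "r > 0" using h0 by (simp add: r_def)
  have hw: "h g = r *\<^sub>R w" using r by (simp add: w_def)
  have ww: "w \<bullet> w = 1" using h0 unfolding w_def r_def norm_eq_1[symmetric] by simp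
  have bw: "b w g = 0"
    using linear_scale[OF b_linear[OF g], of "inverse r" "h g"] b_kernel[OF g] by (simp add: w_def)
  obtain u v l m where f: "frame u v w" and bu: "b u g = l *\<^sub>R u" and bv: "b v g = m *\<^sub>R v"
    using diagonalizing_frame[OF b_linear[OF g] b_sym[OF g] ww bw] by blast
  note fs = frame_simps[OF f]
  have Lh: "L u h g = (c * l) *\<^sub>R u - (r * l) *\<^sub>R v" "L v h g = (c * m) *\<^sub>R v + (r * m) *\<^sub>R u" "L w h g = 0"
    by (simp_all add: Lh_eq[OF g] bu bv bw hw cr.scaleR_left cr.scaleR_right fs mult.commute)
  have D: "r * (L z (b x) g \<bullet> w) = - (b x g \<bullet> L z h g)" for x z
    using Lb_h[OF g, of z x] by (simp add: hw)
  have D1: "r * (L u (b u) g \<bullet> w) = - (c * l\<^sup>2)" "r * (L v (b v) g \<bullet> w) = - (c * m\<^sup>2)"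
    using D[of u u] D[of v v] by (simp_all add: Lh bu bv inner_diff_right inner_add_right fs power2_eq_square)
  have "r * (L u (b v) g \<bullet> w) = r * (l * m)" "r * (L v (b u) g \<bullet> w) = r * (- (l * m))"
    using D[of u v] D[of v u] by (simp_all add: Lh bu bv inner_diff_right inner_add_right fs)
  then have D2: "L u (b v) g \<bullet> w = l * m" "L v (b u) g \<bullet> w = - (l * m)" using r mult_left_cancel[of r] by (blast, metis less_irrefl)
  have Dww: "L w (b w) g \<bullet> w = 0" using D[of w w] r by (simp add: bw)
  \<comment> \<open>The quadratic term of the Codazzi equation drops out because
    \<open>b w g = 0\<close>.\<close>
  have cod: "L x (b w) g \<bullet> y - L w (b x) g \<bullet> y = 2 * (b (cross3 x w) g \<bullet> y)" for x y
    using arg_cong[OF b_codazzi[OF g, of x w], of "\<lambda>z. z \<bullet> y"]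
    by (simp add: bw inner_diff_left)
  have bneg: "b (- v) g = - (m *\<^sub>R v)" using linear_neg[OF b_linear[OF g]] bv by simp
  have "L w (b u) g \<bullet> v = l * m + 2 * m"
    using cod[of u v] Lb_sym[OF g, of u w v] D2 by (simp add: fs bneg)
  moreover have "L w (b v) g \<bullet> u = - (l * m) - 2 * l"
    using cod[of v u] Lb_sym[OF g, of v w u] D2 by (simp add: fs bu)
  ultimately have lm: "l * m = - (l + m)"
    using Lb_sym[OF g, of w u v] by simp
  have E1: "r * (L w (b u) g \<bullet> u) = - (c * l\<^sup>2)"
    using cod[of u u] Lb_sym[OF g, of u w u] D1 by (simp add: fs bneg)
  have E2: "r * (L w (b v) g \<bullet> v) = - (c * m\<^sup>2)"
    using cod[of v v] Lb_sym[OF g, of v w v] D1 by (simp add: fs bu)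
  have t: "tau g = l + m" by (simp add: tau_frame[OF g f] bu bv bw fs)
  have "nu g = l\<^sup>2 + m\<^sup>2" by (simp add: nu_frame[OF g f] bu bv bw fs power2_eq_square)
  also have "\<dots> = (l + m)\<^sup>2 - 2 * (l * m)" by (simp add: power2_eq_square algebra_simps)
  finally have n: "nu g = (tau g)\<^sup>2 + 2 * tau g" using t lm by simp
  show thesis
    by (rule that[OF f hw[unfolded r_def] bu bv bw lm t n E1[unfolded r_def] E2[unfolded r_def] Dww])
qed

lemma nu_zero_imp:
  assumes g: "g \<in> S3" and "nu g = 0"
  shows "b x g = 0"
proof -
  have ge: "b x g \<bullet> b x g \<ge> 0" for x by simp
  have "b (axis 1 1) g = 0" "b (axis 2 1) g = 0" "b (axis 3 1) g = 0"
    using assms(2) ge[of "axis 1 1"] ge[of "axis 2 1"] ge[of "axis 3 1"] unfolding nu_def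
    by (smt (verit) inner_eq_zero_iff)+
  then show ?thesis
    by (subst frame_expansion[OF frame_axis, of x])
       (simp add: linear_add[OF b_linear[OF g]] linear_scale[OF b_linear[OF g]])
qed

text \<open>Differentiate \<open>nu = tau\<^sup>2 + 2 * tau\<close> along \<open>w\<close>: both
  sides are known from \<open>adapted_frame\<close> and carry the nonzero factor
  \<open>c\<close>.\<close>

lemma b_zero_of_c_nonzero:
  assumes c: "c \<noteq> 0" and g: "g \<in> S3"
  shows "b x g = 0"
proof (cases "c\<^sup>2 = 1")
  \<comment> \<open>Now \<open>h\<close> vanishes on the sphere, so no adapted frame is available,
    but the formula for \<open>b\<close> is zero.\<close>
  case True
  then have "h q = 0" if "q \<in> S3" for q using unit[OF that] by simp
  then have "L x h g = L x (\<lambda>q. 0) g" by (intro L_eq_on_S3[OF g] differentiable_S3[OF g]) auto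
  then show ?thesis by (simp add: b_def)
next
  case False
  then have h0: "h q \<noteq> 0" if "q \<in> S3" for q using unit[OF that] by auto
  have nu: "nu q = (tau q)\<^sup>2 + 2 * tau q" if "q \<in> S3" for q
    using adapted_frame[OF that h0[OF that]] by blast
  obtain u v w l m where f: "frame u v w" and fr: "b u g = l *\<^sub>R u" "b v g = m *\<^sub>R v" "b w g = 0"
    and lm: "l * m = - (l + m)" and t: "tau g = l + m"
    and E: "norm (h g) * (L w (b u) g \<bullet> u) = - (c * l\<^sup>2)" "norm (h g) * (L w (b v) g \<bullet> v) = - (c * m\<^sup>2)"
    "L w (b w) g \<bullet> w = 0"
    by (rule adapted_frame[OF g h0[OF g]]) (rule that; assumption)
  have "L w nu g = L w (\<lambda>q. tau q * tau q + 2 *\<^sub>R tau q) g"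
    using nu by (intro L_eq_on_S3[OF g]) (auto simp: power2_eq_square intro!: differentiable_tau_nu_S3[OF g] derivative_intros)
  also have "\<dots> = 2 * (tau g + 1) * L w tau g"
    by (simp add: L_add L_bilinear[OF bounded_bilinear_mult] L_bounded_linear[OF bounded_linear_scaleR_right]
        L_bounded_linear[OF bounded_linear_mult_right] differentiable_tau_nu_S3[OF g] algebra_simps del: real_scaleR_def) simp
  finally have N: "L w nu g = 2 * (tau g + 1) * L w tau g" .
  have N1: "norm (h g) * L w nu g = - 2 * c * (l ^ 3 + m ^ 3)"
    using arg_cong[OF E(1), of "\<lambda>z. z * l"] arg_cong[OF E(2), of "\<lambda>z. z * m"]
    by (simp add: L_nu[OF g f] fr algebra_simps power2_eq_square power3_eq_cube)
  have N2: "norm (h g) * L w tau g = - c * (l\<^sup>2 + m\<^sup>2)"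
    using E by (simp add: L_tau[OF g f] algebra_simps)
  have "norm (h g) * L w nu g = 2 * (tau g + 1) * (norm (h g) * L w tau g)" using N by simp
  then have "(- 2 * c) * (l ^ 3 + m ^ 3) = (- 2 * c) * ((tau g + 1) * (l\<^sup>2 + m\<^sup>2))"
    unfolding N1 N2 by (simp add: algebra_simps)
  then have eq: "l ^ 3 + m ^ 3 = (tau g + 1) * (l\<^sup>2 + m\<^sup>2)" using c by simp
  have l2: "l\<^sup>2 + m\<^sup>2 = (l + m)\<^sup>2 - 2 * (l * m)" by (simp add: power2_eq_square algebra_simps)
  have l3: "l ^ 3 + m ^ 3 = (l + m) ^ 3 - 3 * (l + m) * (l * m)" by (simp add: power3_eq_cube algebra_simps)
  \<comment> \<open>With \<open>l + m = tau\<close> and \<open>l * m = - tau\<close> the equation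
    reads \<open>tau ^ 3 + 3 * tau\<^sup>2 = (tau + 1) * (tau\<^sup>2 + 2 * tau)\<close>, whose
    difference is \<open>2 * tau\<close>.\<close>
  have "tau g = 0"
    using eq unfolding l2 l3 lm t[symmetric] by (simp add: power2_eq_square power3_eq_cube algebra_simps)
  then show ?thesis using nu[OF g] nu_zero_imp[OF g] by simp
qed

end

subsection \<open>Vanishing real part\<close>

locale imaginary_killing_tensor = killing_tensor U h 0 b for U h b
begin

lemma h_unit: "g \<in> S3 \<Longrightarrow> h g \<bullet> h g = 1"
  using unit by simp

lemma h_nonzero: "g \<in> S3 \<Longrightarrow> h g \<noteq> 0"
  using h_unit by fastforce

lemma Lh: "g \<in> S3 \<Longrightarrow> L x h g = cross3 (b x g) (h g)"
  using Lh_eq by simp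

lemma nu_eq: "g \<in> S3 \<Longrightarrow> nu g = (tau g)\<^sup>2 + 2 * tau g"
  by (rule adapted_frame[OF _ h_nonzero]) auto

lemma frame_at:
  assumes g: "g \<in> S3"
  obtains u v l m where "frame u v (h g)" "b u g = l *\<^sub>R u" "b v g = m *\<^sub>R v" "b (h g) g = 0"
    "l * m = - (l + m)" "tau g = l + m"
proof -
  have n: "norm (h g) = 1" using h_unit[OF g] by (simp add: norm_eq_1)
  obtain u v w l m where f: "frame u v w" and hw: "h g = norm (h g) *\<^sub>R w"
    and fr: "b u g = l *\<^sub>R u" "b v g = m *\<^sub>R v" "b w g = 0" "l * m = - (l + m)" "tau g = l + m"
    by (rule adapted_frame[OF g h_nonzero[OF g]]) (rule that; assumption)
  have "w = h g" using hw n by simp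
  then show thesis using that f fr by blast
qed

text \<open>On the plane orthogonal to \<open>h\<close> the map \<open>b\<close> has determinant
  \<open>l * m = - tau\<close>. This rewrites the quadratic Codazzi term through \<open>tau\<close>
  and \<open>h\<close>, in a form that can be differentiated once more.\<close>

lemma cofactor:
  assumes g: "g \<in> S3"
  shows "cross3 (b x g) (b y g) = - ((tau g * (h g \<bullet> cross3 x y)) *\<^sub>R h g)"
proof -
  obtain u v l m where f: "frame u v (h g)" and fr: "b u g = l *\<^sub>R u" "b v g = m *\<^sub>R v" "b (h g) g = 0"
    "l * m = - (l + m)" "tau g = l + m" using frame_at[OF g] .
  note fs = frame_simps[OF f]
  note lin = b_linear[OF g]
  have bx: "b x g = (l * (x \<bullet> u)) *\<^sub>R u + (m * (x \<bullet> v)) *\<^sub>R v" for x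
    by (subst frame_expansion[OF f, of x]) (simp add: linear_add[OF lin] linear_scale[OF lin] fr mult.commute)
  have "cross3 (b x g) (b y g) = (l * m * ((x \<bullet> u) * (y \<bullet> v) - (x \<bullet> v) * (y \<bullet> u))) *\<^sub>R h g"
    unfolding bx
    by (simp add: cr.add_left cr.add_right cr.scaleR_left cr.scaleR_right fs algebra_simps)
  also have "(x \<bullet> u) * (y \<bullet> v) - (x \<bullet> v) * (y \<bullet> u) = h g \<bullet> cross3 x y"
    using dot_cross[of u v x y] by (simp add: fs inner_commute)
  finally show ?thesis unfolding fr(4) fr(5)[symmetric] by simp
qed

lemma codazzi:
  assumes g: "g \<in> S3"
  shows "L x (b y) g \<bullet> k = L y (b x) g \<bullet> k + 2 * (b (cross3 x y) g \<bullet> k)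
     - 2 * (tau g * ((h g \<bullet> cross3 x y) * (h g \<bullet> k)))"
  using arg_cong[OF b_codazzi[OF g, of x y], of "\<lambda>z. z \<bullet> k"]
  by (simp add: cofactor[OF g] inner_diff_left inner_add_left)

lemma LL_codazzi:
  assumes g: "g \<in> S3"
  shows "L z (L x (b y)) g \<bullet> k = L z (L y (b x)) g \<bullet> k + 2 * (L z (b (cross3 x y)) g \<bullet> k)
     - 2 * (L z tau g * ((h g \<bullet> cross3 x y) * (h g \<bullet> k))
         + tau g * ((L z h g \<bullet> cross3 x y) * (h g \<bullet> k) + (h g \<bullet> cross3 x y) * (L z h g \<bullet> k)))"
proof -
  have d1: "(\<lambda>q. F q \<bullet> k) differentiable (at g)" if "F differentiable (at g)" for F :: "quat \<Rightarrow> real^3" and k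
    using that by (auto intro: differentiable_inner)
  have L1: "L z (\<lambda>q. F q \<bullet> k) g = L z F g \<bullet> k" if "F differentiable (at g)" for F :: "quat \<Rightarrow> real^3" and k
    by (rule L_bounded_linear[OF bounded_linear_inner_left that])
  have d2: "(\<lambda>q. 2 * F q) differentiable (at g)" if "F differentiable (at g)" for F :: "quat \<Rightarrow> real"
    using that by (auto intro: derivative_intros)
  have L2: "L z (\<lambda>q. 2 * F q) g = 2 * L z F g" if "F differentiable (at g)" for F :: "quat \<Rightarrow> real"
    by (rule L_bounded_linear[OF bounded_linear_mult_right that])
  have "L z (\<lambda>q. L x (b y) q \<bullet> k) g = L z (\<lambda>q. L y (b x) q \<bullet> k + 2 * (b (cross3 x y) q \<bullet> k)
     - 2 * (tau q * ((h q \<bullet> cross3 x y) * (h q \<bullet> k)))) g"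
    by (intro L_eq_on_S3[OF g] codazzi differentiable_add differentiable_diff differentiable_mult d1 d2 differentiable_S3[OF g] differentiable_tau_nu_S3[OF g])
  also have "\<dots> = L z (L y (b x)) g \<bullet> k + 2 * (L z (b (cross3 x y)) g \<bullet> k)
     - 2 * (L z tau g * ((h g \<bullet> cross3 x y) * (h g \<bullet> k))
         + tau g * ((L z h g \<bullet> cross3 x y) * (h g \<bullet> k) + (h g \<bullet> cross3 x y) * (L z h g \<bullet> k)))"
    by (simp add: L_diff L_add L1 L2 d1 d2 L_bilinear[OF bounded_bilinear_mult] differentiable_S3[OF g] differentiable_tau_nu_S3[OF g]
        differentiable_add differentiable_diff differentiable_mult)
  finally show ?thesis by (simp add: L1 differentiable_S3[OF g])
qed

lemma LL_sym:
  assumes g: "g \<in> S3"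
  shows "L z (L x (b y)) g \<bullet> k = L z (L x (b k)) g \<bullet> y"
proof -
  have "L z (\<lambda>g. L x (b y) g \<bullet> k) g = L z (\<lambda>g. L x (b k) g \<bullet> y) g"
    by (intro L_eq_on_S3[OF g] Lb_sym) (auto intro: differentiable_inner differentiable_S3[OF g])
  then show ?thesis
    by (simp add: L_bounded_linear[OF bounded_linear_inner_left differentiable_S3(5)[OF g]])
qed

lemma LL_commute:
  assumes g: "g \<in> S3"
  shows "L x (L y (b z)) g \<bullet> k = L y (L x (b z)) g \<bullet> k + 2 * (L (cross3 x y) (b z) g \<bullet> k)"
  using arg_cong[OF L_commutator[OF U(1) b_smooth, of g x y z], of "\<lambda>z. z \<bullet> k"] g U
  by (auto simp: inner_diff_left)

lemma Lb_scale:
  assumes g: "g \<in> S3"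
  shows "L z (b (r *\<^sub>R x)) g = r *\<^sub>R L z (b x) g"
proof -
  have "L z (b (r *\<^sub>R x)) g = L z (\<lambda>q. r *\<^sub>R b x q) g"
    using differentiable_S3[OF g]
    by (intro L_eq_on_S3[OF g]) (auto simp: linear_scale[OF b_linear] intro: derivative_intros)
  then show ?thesis by (simp add: L_bounded_linear[OF bounded_linear_scaleR_right] differentiable_S3[OF g])
qed

text \<open>The sign \<open>s\<close> is \<open>-1\<close> when the roles of \<open>u\<close> and \<open>v\<close> are exchanged.\<close>

lemma simons_identity:
  assumes g: "g \<in> S3" and w: "w = h g"
    and cr: "cross3 v u = - (s *\<^sub>R w)" "cross3 w u = s *\<^sub>R v"
    and s: "s * s = 1"
    and orth: "w \<bullet> w = 1" "w \<bullet> u = 0" "w \<bullet> v = 0"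
    and crit: "\<And>z. L z tau g = 0"
    and Luv: "L u h g \<bullet> v = - s * l" and Lvu: "L v h g \<bullet> u = s * m" and Lw: "L w h g = 0"
    and LhO: "\<And>z. L z h g \<bullet> w = 0"
  shows "L v (L v (b u)) g \<bullet> u + L w (L w (b u)) g \<bullet> u
    = L u (L u (b v)) g \<bullet> v + L u (L u (b w)) g \<bullet> w + 2 * tau g * m"
proof -
  note lin = linear_scale[OF L_linear[OF differentiable_S3(4)[OF g]]] linear_neg[OF L_linear[OF differentiable_S3(4)[OF g]]]
  have neg: "L z (b (- x)) g = - L z (b x) g" for z x using Lb_scale[OF g, of z "-1" x] by simp
  have ss: "s * (s * x) = x" for x using s by (simp add: mult.assoc[symmetric])
  \<comment> \<open>\<open>a1\<close> to \<open>a4\<close> carry the second derivative along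
    \<open>v\<close> of the \<open>uu\<close> entry to the one along \<open>u\<close> of the
    \<open>vv\<close> entry: exchange slots by Codazzi, commute derivatives, use symmetry, exchange
    slots again. \<open>b1\<close> to \<open>b4\<close> do the same with \<open>w\<close> in place
    of \<open>v\<close>, and in the sum all first derivatives cancel.\<close>
  have a1: "L v (L v (b u)) g \<bullet> u = L v (L u (b v)) g \<bullet> u - 2 * s * (L v (b w) g \<bullet> u) + 2 * tau g * m"
    using LL_codazzi[OF g, of v v u u] s crit orth Lvu LhO w[symmetric]
    by (simp add: cr neg ss Lb_scale[OF g] algebra_simps)
  have a2: "L v (L u (b v)) g \<bullet> u = L u (L v (b v)) g \<bullet> u - 2 * s * (L w (b v) g \<bullet> u)"
    using LL_commute[OF g, of v u v u] by (simp add: cr lin)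
  have a3: "L u (L v (b v)) g \<bullet> u = L u (L v (b u)) g \<bullet> v" by (rule LL_sym[OF g])
  have a4: "L u (L v (b u)) g \<bullet> v = L u (L u (b v)) g \<bullet> v - 2 * s * (L u (b w) g \<bullet> v) - 2 * tau g * l"
    using LL_codazzi[OF g, of u v u v] s crit orth Luv LhO w[symmetric]
    by (simp add: cr neg ss Lb_scale[OF g] algebra_simps)
  have b1: "L w (L w (b u)) g \<bullet> u = L w (L u (b w)) g \<bullet> u + 2 * s * (L w (b v) g \<bullet> u)"
    using LL_codazzi[OF g, of w w u u] crit orth Lw w[symmetric]
    by (simp add: cr neg ss Lb_scale[OF g] algebra_simps)
  have b2: "L w (L u (b w)) g \<bullet> u = L u (L w (b w)) g \<bullet> u + 2 * s * (L v (b w) g \<bullet> u)"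
    using LL_commute[OF g, of w u w u] by (simp add: cr lin)
  have b3: "L u (L w (b w)) g \<bullet> u = L u (L w (b u)) g \<bullet> w" by (rule LL_sym[OF g])
  have b4: "L u (L w (b u)) g \<bullet> w = L u (L u (b w)) g \<bullet> w + 2 * s * (L u (b v) g \<bullet> w) + 2 * tau g * l"
    using LL_codazzi[OF g, of u w u w] s crit orth Luv w[symmetric]
    by (simp add: cr neg ss Lb_scale[OF g] algebra_simps)
  have d: "L u (b v) g \<bullet> w = L u (b w) g \<bullet> v" by (rule Lb_sym[OF g])
  show ?thesis unfolding a1 a2 a3 a4 b1 b2 b3 b4 d by simp
qed

lemma LL_tau:
  assumes g: "g \<in> S3" and f: "frame u v w"
  shows "L x (L x tau) g = L x (L x (b u)) g \<bullet> u + L x (L x (b v)) g \<bullet> v + L x (L x (b w)) g \<bullet> w"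
proof -
  have "L x (L x tau) g = L x (\<lambda>g. L x (b u) g \<bullet> u + L x (b v) g \<bullet> v + L x (b w) g \<bullet> w) g"
    by (intro L_eq_on_S3[OF g] L_tau[OF _ f] differentiable_tau_nu_S3[OF g] differentiable_add differentiable_inner differentiable_S3[OF g])
       auto
  also have "\<dots> = L x (L x (b u)) g \<bullet> u + L x (L x (b v)) g \<bullet> v + L x (L x (b w)) g \<bullet> w"
    by (simp add: L_add L_bounded_linear[OF bounded_linear_inner_left] differentiable_S3[OF g] differentiable_add differentiable_inner)
  finally show ?thesis .
qed

lemma LL_nu:
  assumes g: "g \<in> S3" and f: "frame u v w"
  shows "L x (L x nu) g = 2 * (L x (L x (b u)) g \<bullet> b u g + L x (L x (b v)) g \<bullet> b v g + L x (L x (b w)) g \<bullet> b w g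
    + (L x (b u) g \<bullet> L x (b u) g + L x (b v) g \<bullet> L x (b v) g + L x (b w) g \<bullet> L x (b w) g))"
proof -
  let ?F = "\<lambda>g. L x (b u) g \<bullet> b u g + L x (b v) g \<bullet> b v g + L x (b w) g \<bullet> b w g"
  have d: "?F differentiable (at g)"
    by (intro differentiable_add differentiable_inner differentiable_S3[OF g])
  have "L x (L x nu) g = L x (\<lambda>g. 2 * ?F g) g"
    by (intro L_eq_on_S3[OF g] L_nu[OF _ f] differentiable_tau_nu_S3[OF g] differentiable_mult d) auto
  also have "\<dots> = 2 * L x ?F g" by (rule L_bounded_linear[OF bounded_linear_mult_right d])
  also have "L x ?F g = L x (L x (b u)) g \<bullet> b u g + L x (L x (b v)) g \<bullet> b v g + L x (L x (b w)) g \<bullet> b w g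
    + (L x (b u) g \<bullet> L x (b u) g + L x (b v) g \<bullet> L x (b v) g + L x (b w) g \<bullet> L x (b w) g)"
    by (simp add: L_add L_bilinear[OF bounded_bilinear_inner] differentiable_S3[OF g] differentiable_add differentiable_inner)
  finally show ?thesis .
qed

lemma LL_nu_tau:
  assumes g: "g \<in> S3"
  shows "L x (L x nu) g = 2 * ((L x tau g)\<^sup>2 + (tau g + 1) * L x (L x tau) g)"
proof -
  have 1: "L x nu q = 2 * ((tau q + 1) * L x tau q)" if q: "q \<in> S3" for q
  proof -
    have "L x nu q = L x (\<lambda>q. tau q * tau q + 2 * tau q) q"
      by (intro L_eq_on_S3[OF q] differentiable_tau_nu_S3[OF q] differentiable_add differentiable_mult)
         (auto simp: nu_eq power2_eq_square)
    also have "\<dots> = 2 * ((tau q + 1) * L x tau q)"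
      by (simp add: L_add L_bilinear[OF bounded_bilinear_mult] L_bounded_linear[OF bounded_linear_mult_right]
        differentiable_tau_nu_S3[OF q] differentiable_mult algebra_simps)
    finally show ?thesis .
  qed
  have d: "(\<lambda>q. (tau q + 1) * L x tau q) differentiable (at g)"
    by (intro differentiable_mult differentiable_add differentiable_tau_nu_S3[OF g]) auto
  have "L x (L x nu) g = L x (\<lambda>q. 2 * ((tau q + 1) * L x tau q)) g"
    by (intro L_eq_on_S3[OF g] 1 differentiable_tau_nu_S3[OF g] differentiable_mult d) auto
  also have "\<dots> = 2 * L x (\<lambda>q. (tau q + 1) * L x tau q) g"
    by (rule L_bounded_linear[OF bounded_linear_mult_right d])
  also have "L x (\<lambda>q. (tau q + 1) * L x tau q) g = (L x tau g)\<^sup>2 + (tau g + 1) * L x (L x tau) g"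
    by (simp add: L_bilinear[OF bounded_bilinear_mult] L_add differentiable_tau_nu_S3[OF g] power2_eq_square)
  finally show ?thesis .
qed

text \<open>The second derivatives of \<open>nu\<close> are computed once from the entries of
  \<open>b\<close> and once from \<open>nu = tau\<^sup>2 + 2 * tau\<close>, and summed over the
  frame; the two Simons identities eliminate second derivatives of \<open>b\<close> in favour of
  those of \<open>tau\<close>.\<close>

lemma critical_inequality:
  assumes g: "g \<in> S3" and crit: "\<And>z. L z tau g = 0" and t: "tau g * (tau g + 4) > 0"
  obtains u v w l m where "norm u = 1" "norm v = 1" "norm w = 1"
    "(1 + l) * (1 + m) = 1" "tau g = l + m"
    "(1 + m) * L u (L u tau) g + (1 + l) * L v (L v tau) g + (1 + tau g) * L w (L w tau) g > 0"
proof -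
  define w where "w = h g"
  obtain u v l m where f: "frame u v w" and fr: "b u g = l *\<^sub>R u" "b v g = m *\<^sub>R v" "b w g = 0"
    and lm: "l * m = - (l + m)" and tau: "tau g = l + m" unfolding w_def using frame_at[OF g] .
  note fs = frame_simps[OF f]
  have Lhs: "L u h g = - l *\<^sub>R v" "L v h g = m *\<^sub>R u" "L w h g = 0"
    by (simp_all add: Lh[OF g] fr w_def[symmetric] cr.scaleR_left fs)
  have LhO: "L z h g \<bullet> w = 0" for z using Lh_orth[OF g] by (simp add: w_def)
  have s1: "L v (L v (b u)) g \<bullet> u + L w (L w (b u)) g \<bullet> u
    = L u (L u (b v)) g \<bullet> v + L u (L u (b w)) g \<bullet> w + 2 * tau g * m"
    by (rule simons_identity[OF g w_def, of v u 1]) (simp_all add: fs crit Lhs LhO)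
  have s2: "L u (L u (b v)) g \<bullet> v + L w (L w (b v)) g \<bullet> v
    = L v (L v (b u)) g \<bullet> u + L v (L v (b w)) g \<bullet> w + 2 * tau g * l"
    by (rule simons_identity[OF g w_def, of u v "-1"]) (simp_all add: fs crit Lhs LhO)
  let ?n = "\<lambda>x. L x (b u) g \<bullet> L x (b u) g + L x (b v) g \<bullet> L x (b v) g + L x (b w) g \<bullet> L x (b w) g"
  \<comment> \<open>The two expressions for the second derivative of \<open>nu\<close>; the square
    of \<open>L x tau g\<close> vanishes at the critical point.\<close>
  have N: "l * (L x (L x (b u)) g \<bullet> u) + m * (L x (L x (b v)) g \<bullet> v) + ?n x = (tau g + 1) * L x (L x tau) g" for x
    using LL_nu[OF g f, of x] LL_nu_tau[OF g, of x] by (simp add: fr crit)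
  \<comment> \<open>Differentiating \<open>b(x) \<bullet> h = 0\<close> fixes these entries as
    \<open>l * m\<close> and \<open>- (l * m)\<close>, where \<open>l * m = - tau\<close>.\<close>
  have Du: "L u (b v) g \<bullet> w = - tau g" "L v (b u) g \<bullet> w = tau g"
    using Lb_h[OF g, of u v] Lb_h[OF g, of v u] lm mult.commute[of m l]
    by (simp_all add: fr Lhs w_def[symmetric] fs tau)
  then have Dw: "L u (b w) g \<bullet> v = - tau g" "L v (b w) g \<bullet> u = tau g"
    using Lb_sym[OF g] by metis+
  have Dwu: "L w (b u) g \<bullet> v = m - l"
    using codazzi[OF g, of w u v] Dw lm by (simp add: fs fr w_def[symmetric] tau)
  then have Dwv: "L w (b v) g \<bullet> u = m - l" using Lb_sym[OF g] by metis
  have ge: "0 \<le> L x (b x) g \<bullet> L x (b x) g" for x by simp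
  \<comment> \<open>Each bound retains two known off-diagonal entries of the derivative of
    \<open>b\<close> and discards the other nonnegative contributions.\<close>
  have nw: "?n w \<ge> 2 * (m - l)\<^sup>2"
    using inner_sq_le[of v "L w (b u) g", unfolded Dwu] inner_sq_le[of u "L w (b v) g", unfolded Dwv] fs ge[of w]
    by linarith
  have nu: "?n u \<ge> 2 * (tau g)\<^sup>2"
    using inner_sq_le[of w "L u (b v) g", unfolded Du] inner_sq_le[of v "L u (b w) g", unfolded Dw] fs ge[of u]
      power2_minus[of "tau g"] by linarith
  have nv: "?n v \<ge> 2 * (tau g)\<^sup>2"
    using inner_sq_le[of w "L v (b u) g", unfolded Du] inner_sq_le[of u "L v (b w) g", unfolded Dw] fs ge[of v]
    by linarith
  have sq: "(m - l)\<^sup>2 = tau g * (tau g + 4)"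
  proof -
    have "(m - l)\<^sup>2 = (l + m)\<^sup>2 - 4 * (l * m)" by (simp add: power2_eq_square algebra_simps)
    then show ?thesis unfolding lm tau by (simp add: power2_eq_square algebra_simps)
  qed
  have "(1 + m) * L u (L u tau) g + (1 + l) * L v (L v tau) g + (1 + tau g) * L w (L w tau) g
      = ?n u + ?n v + ?n w + 4 * tau g * (l * m)"
  proof -
    have E1: "l * (L v (L v (b u)) g \<bullet> u + L w (L w (b u)) g \<bullet> u + L u (L u (b u)) g \<bullet> u) = l * (L u (L u tau) g + 2 * tau g * m)"
      using s1 LL_tau[OF g f, of u] by simp
    have E2: "m * (L u (L u (b v)) g \<bullet> v + L w (L w (b v)) g \<bullet> v + L v (L v (b v)) g \<bullet> v) = m * (L v (L v tau) g + 2 * tau g * l)"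
      using s2 LL_tau[OF g f, of v] by simp
    \<comment> \<open>Moving the terms weighted by \<open>l\<close> and \<open>m\<close> to the left
      leaves the weights \<open>1 + tau - l = 1 + m\<close> and
      \<open>1 + tau - m = 1 + l\<close>.\<close>
    have "(tau g + 1) * (L u (L u tau) g + L v (L v tau) g + L w (L w tau) g)
      = l * (L u (L u tau) g + 2 * tau g * m) + m * (L v (L v tau) g + 2 * tau g * l) + (?n u + ?n v + ?n w)"
      using N[of u] N[of v] N[of w] E1 E2 by (simp add: algebra_simps)
    then show ?thesis unfolding tau by (simp add: algebra_simps)
  qed
  moreover have "4 * tau g * (l * m) = - 4 * (tau g)\<^sup>2" unfolding lm tau[symmetric] by (simp add: power2_eq_square)
  ultimately have pos: "(1 + m) * L u (L u tau) g + (1 + l) * L v (L v tau) g + (1 + tau g) * L w (L w tau) g > 0"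
    using nw nu nv sq t by linarith
  have "(1 + l) * (1 + m) = 1" using lm by (simp add: algebra_simps)
  then show thesis using that[OF _ _ _ _ tau pos] fs by (simp add: norm_eq_1)
qed

section \<open>Maximum principle and rigidity of the trace\<close>

lemma tau_continuous: "continuous_on S3 tau"
  using differentiable_tau_nu_S3(1) by (meson continuous_at_imp_continuous_on differentiable_imp_continuous_within)

text \<open>At a positive maximum all three weights in \<open>critical_inequality\<close> are
  positive while the second derivatives are nonpositive.\<close>

lemma tau_le_0:
  assumes "q \<in> S3"
  shows "tau q \<le> 0"
proof -
  obtain g where g: "g \<in> S3" and max: "\<And>p. p \<in> S3 \<Longrightarrow> tau p \<le> tau g"
    using continuous_attains_sup[OF compact_S3 S3_nonempty tau_continuous] by blast
  have max1: "L z tau g = 0" "L z (L z tau) g \<le> 0" if "norm z = 1" for z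
    using L_at_max[OF U tau_smooth g max that] by simp_all
  have crit: "L z tau g = 0" for z
    by (rule L_eq_0_from_unit[OF differentiable_tau_nu_S3(1)[OF g] max1(1)])
  have "tau g \<le> 0"
  proof (rule ccontr)
    assume n: "\<not> tau g \<le> 0"
    then have "tau g * (tau g + 4) > 0" by simp
    then obtain u v w l m where n1: "norm u = 1" "norm v = 1" "norm w = 1"
      and lm: "(1 + l) * (1 + m) = 1" "tau g = l + m"
      and pos: "(1 + m) * L u (L u tau) g + (1 + l) * L v (L v tau) g + (1 + tau g) * L w (L w tau) g > 0"
      using critical_inequality[OF g crit] by metis
    have "1 + l > 0" "1 + m > 0" using sum_product_pos[OF lm(1)] lm(2) n by simp_all
    then have "(1 + m) * L u (L u tau) g \<le> 0" "(1 + l) * L v (L v tau) g \<le> 0" "(1 + tau g) * L w (L w tau) g \<le> 0"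
      using max1(2) n1 n by (simp_all add: mult_nonneg_nonpos)
    then show False using pos by simp
  qed
  then show ?thesis using max[OF assms] by simp
qed

text \<open>Mirror argument at a minimum below -4, with the second derivative test applied to
  \<open>- tau\<close>: the weights are negative and the second derivatives nonnegative.\<close>

lemma tau_ge_minus_4:
  assumes "q \<in> S3"
  shows "tau q \<ge> - 4"
proof -
  obtain g where g: "g \<in> S3" and min: "\<And>p. p \<in> S3 \<Longrightarrow> tau g \<le> tau p"
    using continuous_attains_inf[OF compact_S3 S3_nonempty tau_continuous] by blast
  have Ln: "L z (\<lambda>p. - F p) p = - L z F p" if "F differentiable (at p)" for z p and F :: "quat \<Rightarrow> real"
    using L_bounded_linear[OF bounded_linear_minus[OF bounded_linear_ident] that] by simp
  have min1: "L z tau g = 0" "L z (L z tau) g \<ge> 0" if "norm z = 1" for z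
  proof -
    have s: "Ck (Suc (Suc 0)) U (\<lambda>p. - tau p)"
      by (rule Ck_bounded_linear[OF bounded_linear_minus[OF bounded_linear_ident] U(1) tau_smooth])
    have "L z (\<lambda>p. - tau p) g = 0" "L z (L z (\<lambda>p. - tau p)) g \<le> 0"
      using L_at_max[OF U s g _ that] min by simp_all
    moreover have "L z (L z (\<lambda>p. - tau p)) g = L z (\<lambda>p. - L z tau p) g"
    proof (rule L_eq_on_S3[OF g])
      show "L z (\<lambda>p. - tau p) p = - L z tau p" if "p \<in> S3" for p using Ln[OF differentiable_tau_nu_S3(1)[OF that]] .
      show "L z (\<lambda>p. - tau p) differentiable (at g)"
        by (rule Ck_differentiable[OF Ck_L[OF U(1) s] subsetD[OF U(2) g]])
      show "(\<lambda>p. - L z tau p) differentiable (at g)" using differentiable_tau_nu_S3(2)[OF g] by simp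
    qed
    ultimately show "L z tau g = 0" "L z (L z tau) g \<ge> 0"
      by (simp_all add: Ln differentiable_tau_nu_S3[OF g])
  qed
  have crit: "L z tau g = 0" for z
    by (rule L_eq_0_from_unit[OF differentiable_tau_nu_S3(1)[OF g] min1(1)])
  have "tau g \<ge> - 4"
  proof (rule ccontr)
    assume n: "\<not> tau g \<ge> - 4"
    then have "tau g * (tau g + 4) > 0" by (intro mult_neg_neg) auto
    then obtain u v w l m where n1: "norm u = 1" "norm v = 1" "norm w = 1"
      and lm: "(1 + l) * (1 + m) = 1" "tau g = l + m"
      and pos: "(1 + m) * L u (L u tau) g + (1 + l) * L v (L v tau) g + (1 + tau g) * L w (L w tau) g > 0"
      using critical_inequality[OF g crit] by metis
    have "1 + l < 0" "1 + m < 0" using sum_product_neg[OF lm(1)] lm(2) n by simp_all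
    then have "(1 + m) * L u (L u tau) g \<le> 0" "(1 + l) * L v (L v tau) g \<le> 0" "(1 + tau g) * L w (L w tau) g \<le> 0"
      using min1(2) n1 n by (simp_all add: mult_nonpos_nonneg)
    then show False using pos by simp
  qed
  then show ?thesis using min[OF assms] by simp
qed

text \<open>The real eigenvalues \<open>l\<close>, \<open>m\<close> have sum \<open>tau\<close> and
  product \<open>- tau\<close>, so the discriminant \<open>tau * (tau + 4)\<close> is nonnegative.
  This rules out the open interval left by the two bounds.\<close>

lemma tau_values:
  assumes g: "g \<in> S3"
  shows "tau g = 0 \<or> tau g = - 4"
proof -
  obtain u v l m where "l * m = - (l + m)" "tau g = l + m" using frame_at[OF g] .
  then have "tau g * (tau g + 4) = (l - m)\<^sup>2" by (simp add: power2_eq_square algebra_simps)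
  then have "tau g * (tau g + 4) \<ge> 0" by simp
  then have "\<not> (tau g < 0 \<and> 0 < tau g + 4)" by (metis mult_neg_pos not_less)
  then show ?thesis using tau_le_0[OF g] tau_ge_minus_4[OF g] by auto
qed

lemma tau_constant:
  "(\<forall>g\<in>S3. tau g = 0) \<or> (\<forall>g\<in>S3. tau g = - 4)"
proof (rule ccontr)
  assume "\<not> ?thesis"
  then obtain p q where p: "p \<in> S3" "tau p = - 4" and q: "q \<in> S3" "tau q = 0"
    using tau_values by metis
  have "connected (tau ` S3)"
    using tau_continuous connected_continuous_image connected_sphere[of "0::quat" 1]
    by (simp add: S3_def)
  moreover have "- 4 \<in> tau ` S3" "0 \<in> tau ` S3" using p q by (metis imageI)+
  \<comment> \<open>Any number strictly between -4 and 0 would serve.\<close>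
  ultimately have "- 1 \<in> tau ` S3"
    by (meson connectedD_interval neg_le_0_iff_le one_le_numeral neg_le_iff_le zero_le_one)
  then show False using tau_values by fastforce
qed

text \<open>At -4 the discriminant vanishes, so \<open>l = m = - 2\<close> and \<open>b\<close> is a
  multiple of the orthogonal projection along \<open>h\<close>.\<close>

lemma b_of_tau:
  assumes g: "g \<in> S3"
  shows "tau g = 0 \<Longrightarrow> b x g = 0" "tau g = - 4 \<Longrightarrow> b x g = - 2 *\<^sub>R (x - (x \<bullet> h g) *\<^sub>R h g)"
proof -
  assume "tau g = 0"
  then show "b x g = 0" using nu_eq[OF g] nu_zero_imp[OF g] by simp
next
  assume t: "tau g = - 4"
  obtain u v l m where f: "frame u v (h g)" and fr: "b u g = l *\<^sub>R u" "b v g = m *\<^sub>R v" "b (h g) g = 0"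
    and lm: "l * m = - (l + m)" "tau g = l + m" using frame_at[OF g] .
  have "(l - m)\<^sup>2 = (l + m)\<^sup>2 - 4 * (l * m)" by (simp add: power2_eq_square algebra_simps)
  then have "(l - m)\<^sup>2 = 0" using lm t by simp
  then have "l = - 2" "m = - 2" using lm t by simp_all
  note lin = b_linear[OF g]
  have "b x g = - 2 *\<^sub>R ((x \<bullet> u) *\<^sub>R u + (x \<bullet> v) *\<^sub>R v)"
    by (subst frame_expansion[OF f, of x])
       (simp add: linear_add[OF lin] linear_scale[OF lin] fr \<open>l = - 2\<close> \<open>m = - 2\<close> scaleR_add_right mult.commute)
  also have "(x \<bullet> u) *\<^sub>R u + (x \<bullet> v) *\<^sub>R v = x - (x \<bullet> h g) *\<^sub>R h g"
    using frame_expansion[OF f, of x] by (simp add: algebra_simps)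
  finally show "b x g = - 2 *\<^sub>R (x - (x \<bullet> h g) *\<^sub>R h g)" .
qed

end

subsection \<open>The classification\<close>

lemma clifford_left: "g \<in> S3 \<Longrightarrow> clifford g (qmul g (iq x)) s = qmul (iq x) s"
  by (simp add: clifford_def S3_cancel)

text \<open>Left translation by \<open>g\<close> is an isometry, so it carries the endomorphism to a
  symmetric map of three-space; the zeroth-order term of \<open>nabla\<close> shifts it by one
  half.\<close>

lemma gen_killing_derivative:
  assumes gk: "gen_killing f" and g: "g \<in> S3"
  obtains \<beta> where "\<And>x. L x f g = qmul (iq (\<beta> x)) (f g)" "\<And>x y. \<beta> x \<bullet> y = \<beta> y \<bullet> x"
proof -
  obtain A where A: "sym_endo g (A g)"
    "\<And>X. tangent g X \<Longrightarrow> nabla f g X = clifford g (A g X) (f g)"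
    using gk g unfolding gen_killing_def by blast
  have tan: "tangent g (qmul g (iq x))" for x using tangent_iff[OF g] by blast
  have "\<forall>x. \<exists>a. A g (qmul g (iq x)) = qmul g (iq a)"
    using A(1) tan tangent_iff[OF g] unfolding sym_endo_def by metis
  then obtain a where a: "\<And>x. A g (qmul g (iq x)) = qmul g (iq (a x))" by metis
  show thesis
  proof (rule that[of "\<lambda>x. a x - (1/2) *\<^sub>R x"])
    fix x y
    have "nabla f g (qmul g (iq x)) = qmul (iq (a x)) (f g)"
      using A(2)[OF tan[of x]] by (simp add: a clifford_left[OF g])
    then show "L x f g = qmul (iq (a x - (1/2) *\<^sub>R x)) (f g)"
      unfolding nabla_def L_def[symmetric] clifford_left[OF g] iq_diff iq_scale qmul.diff_left qmul.scaleR_left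
      by (metis add_diff_cancel)
    have "A g (qmul g (iq x)) \<bullet> qmul g (iq y) = qmul g (iq x) \<bullet> A g (qmul g (iq y))"
      using A(1) tan unfolding sym_endo_def by blast
    then have "a x \<bullet> y = x \<bullet> a y"
      using g by (auto simp add: a inner_qmul_left S3_inner)
    then show "(a x - (1/2) *\<^sub>R x) \<bullet> y = (a y - (1/2) *\<^sub>R y) \<bullet> x"
      by (simp add: inner_diff_left inner_diff_right inner_commute)
  qed
qed

text \<open>The zeroth-order term of \<open>nabla\<close> cancels exactly against the Killing term
  with constant one half.\<close>

lemma killing_half_iff:
  "killing (1/2) f \<longleftrightarrow> (\<forall>g\<in>S3. \<forall>x. L x f g = 0)"
  unfolding killing_def nabla_def by (auto simp: tangent_iff L_def simp del: split_paired_All)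

theorem theorem5p2:
  fixes f :: "quat \<Rightarrow> quat" and V :: "quat \<Rightarrow> quat" and \<alpha> :: "quat \<Rightarrow> real"
  assumes smooth: "smooth_spinor f"
    and unit: "\<forall>g\<in>S3. norm (f g) = 1"
    and gk: "gen_killing f"
    and V_tan: "\<forall>g\<in>S3. tangent g (V g)"
    and decomp: "\<forall>g\<in>S3. f g = clifford g (V g) (qreal 1) + qreal (\<alpha> g)"
    and alpha_const: "\<exists>c. \<forall>g\<in>S3. \<alpha> g = c"
  shows "killing (1/2) f \<or>
         ((\<forall>g\<in>S3. \<alpha> g = 0) \<and>
          (\<exists>b. imq b \<and> norm b = 1 \<and>
               (\<forall>g\<in>S3. f g = clifford g (qmul b g) (qreal 1))))"
proof -
  obtain U where U: "open U" "S3 \<subseteq> U" and sm: "smooth_on U f"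
    using smooth by (auto simp: smooth_spinor_def smooth_on_def)
  obtain c where c: "\<And>g. g \<in> S3 \<Longrightarrow> \<alpha> g = c" using alpha_const by blast
  have f_smooth: "Ck n U f" for n using smooth_on_imp_Ck[OF sm, of n "[]"] by simp
  define h where "h = (\<lambda>g. vq (f g))"
  define b where "b = (\<lambda>x g. c *\<^sub>R L x h g - cross3 (L x h g) (h g))"
  have blv: "bounded_linear vq" and blr: "bounded_linear qre"
    using linear_vq linear_conv_bounded_linear bounded_linear_fst by (auto simp: qre_def[abs_def])
  have h_smooth: "Ck n U h" for n
    unfolding h_def by (rule Ck_bounded_linear[OF blv U(1) f_smooth])
  have df: "f differentiable (at g)" if "g \<in> S3" for g
    by (rule Ck_differentiable[OF f_smooth subsetD[OF U(2) that]])
  have re: "qre (f g) = c" if g: "g \<in> S3" for g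
  proof -
    obtain x where "V g = qmul g (iq x)" using V_tan tangent_iff[OF g] g by blast
    then have "f g = iq x + qreal c" using decomp g by (simp add: clifford_left c)
    then show ?thesis by (simp add: qre_def iq_def qreal_def)
  qed
  have fh: "f g = qreal c + iq (h g)" if "g \<in> S3" for g
    using iq_vq[of "f g"] re[OF that] by (simp add: h_def)
  have Lf: "L x f g = iq (L x h g)" if g: "g \<in> S3" for g x
  proof -
    have "qre (L x f g) = L x (\<lambda>g. qre (f g)) g" by (rule L_bounded_linear[OF blr df[OF g], symmetric])
    also have "\<dots> = L x (\<lambda>g. c) g"
      by (rule L_eq_on_S3[OF g re]) (use df[OF g] in \<open>auto intro: bounded_linear.has_derivative[OF blr] simp: differentiable_def\<close>)
    finally have "qre (L x f g) = 0" by simp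
    moreover have "L x h g = vq (L x f g)" unfolding h_def by (rule L_bounded_linear[OF blv df[OF g]])
    ultimately show ?thesis by (simp add: iq_vq qreal_def zero_prod_def)
  qed
  have unit_h: "c\<^sup>2 + h g \<bullet> h g = 1" if "g \<in> S3" for g
  proof -
    have "f g \<bullet> f g = 1" using unit that by (simp add: norm_eq_1)
    then show ?thesis unfolding fh[OF that]
      by (simp add: qreal_def iq_def inner_vec_def sum_3 power2_eq_square)
  qed
  have sym: "b x g \<bullet> y = b y g \<bullet> x" if g: "g \<in> S3" for g x y
  proof -
    obtain \<beta> where \<beta>: "\<And>x. L x f g = qmul (iq (\<beta> x)) (f g)" and s: "\<And>x y. \<beta> x \<bullet> y = \<beta> y \<bullet> x"
      using gen_killing_derivative[OF gk g] by metis
    \<comment> \<open>On the sphere \<open>b\<close> recovers the pointwise map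
      \<open>\<beta>\<close>, from which it inherits symmetry. Since \<open>L x f\<close> has no
      real part, \<open>\<beta> x\<close> is orthogonal to \<open>h\<close>, so the inversion
      formula applies to it.\<close>
    have "b x g = \<beta> x" for x
    proof -
      have eq: "iq (L x h g) = iq (c *\<^sub>R \<beta> x + cross3 (\<beta> x) (h g)) - qreal (\<beta> x \<bullet> h g)"
        using \<beta>[of x] unfolding Lf[OF g] fh[OF g]
        by (simp add: qmul.add_right qmul_iq iq_add iq_scale)
      have orth: "\<beta> x \<bullet> h g = 0" using arg_cong[OF eq, of fst] by (simp add: iq_def qreal_def)
      then have Lh: "L x h g = c *\<^sub>R \<beta> x + cross3 (\<beta> x) (h g)" using eq by (simp add: qreal_def zero_prod_def[symmetric])
      have "cross3 (cross3 (\<beta> x) (h g)) (h g) = - ((h g \<bullet> h g) *\<^sub>R \<beta> x)"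
        using orth cross_skew[of "cross3 (\<beta> x) (h g)" "h g"] by (simp add: Lagrange inner_commute)
      then have "b x g = (c\<^sup>2 + h g \<bullet> h g) *\<^sub>R \<beta> x"
        by (simp add: b_def Lh cr.add_left cr.scaleR_left algebra_simps power2_eq_square)
      then show ?thesis using unit_h[OF g] by simp
    qed
    then show ?thesis using s by simp
  qed
  interpret K: killing_tensor U h c b
    by unfold_locales (use U h_smooth unit_h b_def sym in auto)
  have kill: "killing (1/2) f" if "\<And>g x. g \<in> S3 \<Longrightarrow> b x g = 0"
    unfolding killing_half_iff using that Lf K.Lh_eq by (simp add: iq_def zero_prod_def)
  show ?thesis
  proof (cases "c = 0")
    case False
    then show ?thesis using kill K.b_zero_of_c_nonzero by blast
  next
    case True
    then interpret Z: imaginary_killing_tensor U h b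
      using K.killing_tensor_axioms by (simp add: imaginary_killing_tensor_def)
    consider "\<forall>g\<in>S3. Z.tau g = 0" | "\<forall>g\<in>S3. Z.tau g = - 4" using Z.tau_constant by blast
    then show ?thesis
    proof cases
      case 1
      then show ?thesis using kill Z.b_of_tau(1) by blast
    next
      case 2
      have f_iq: "f g = iq (h g)" if "g \<in> S3" for g
        using fh[OF that] True by (simp add: qreal_def zero_prod_def[symmetric])
      \<comment> \<open>The component of \<open>x\<close> along \<open>h\<close> disappears in the
        cross product with \<open>h\<close>.\<close>
      have Lf': "L x f g = - 2 *\<^sub>R iq (cross3 x (h g))" if g: "g \<in> S3" for g x
        using 2 g Lf[OF g] Z.Lh[OF g] Z.b_of_tau(2)[OF g]
        by (simp add: cr.scaleR_left cr.diff_left iq_scale iq_minus)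
      \<comment> \<open>A right-invariant field \<open>B g\<close> has left-trivialized value
        \<open>qmul (qcnj g) (qmul B g)\<close>; conjugating back by \<open>g\<close> should
        therefore return the constant \<open>B\<close>.\<close>
      define G where "G = (\<lambda>g. qmul (qmul g (f g)) (qcnj g))"
      have blc: "bounded_linear qcnj"
        by (intro linear_conv_bounded_linear[THEN iffD1] linearI) auto
      have did: "(\<lambda>g. g) differentiable (at g)" for g :: quat by simp
      have dc: "qcnj differentiable (at g)" for g using blc by (rule bounded_linear_imp_differentiable)
      have dgf: "(\<lambda>g. qmul g (f g)) differentiable (at g)" if "g \<in> S3" for g
        using qmul.FDERIV[OF did[THEN differentiable_works] df[OF that, THEN differentiable_works]]
        by (auto simp: differentiable_def)
      have dG: "G differentiable (at g)" if "g \<in> S3" for g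
        using qmul.FDERIV[OF dgf[OF that, THEN differentiable_works] dc[THEN differentiable_works]]
        by (auto simp: differentiable_def G_def)
      have LG: "L x G g = 0" if g: "g \<in> S3" for g x
      proof -
        have Lid: "L x (\<lambda>g. g) g = qmul g (iq x)" by (simp add: L_def)
        have Lc: "L x qcnj g = - qmul (iq x) (qcnj g)"
        proof -
          have "L x qcnj g = qcnj (qmul g (iq x))"
            using L_bounded_linear[OF blc did, of x g] Lid by simp
          also have "qcnj (iq x) = - iq x" by (simp add: iq_def)
          then have "qcnj (qmul g (iq x)) = - qmul (iq x) (qcnj g)"
            by (simp add: qcnj_qmul qmul.minus_left)
          finally show ?thesis .
        qed
        have "L x G g = qmul (qmul (qmul g (iq x)) (f g) + qmul g (L x f g)) (qcnj g)
            + qmul (qmul g (f g)) (- qmul (iq x) (qcnj g))"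
          unfolding G_def L_bilinear[OF bounded_bilinear_qmul dgf[OF g] dc]
            L_bilinear[OF bounded_bilinear_qmul did df[OF g]] Lc Lid ..
        also have "\<dots> = qmul (qmul g (qmul (iq x) (f g) + L x f g - qmul (f g) (iq x))) (qcnj g)"
          by (simp add: qmul_assoc qmul.add_right qmul.add_left qmul.diff_right qmul.diff_left qmul.minus_right)
        \<comment> \<open>The commutator of \<open>x\<close> and \<open>h\<close> is
          \<open>2 (x \<times> h)\<close>, exactly opposite to \<open>L x f\<close>.\<close>
        also have "qmul (iq x) (f g) + L x f g - qmul (f g) (iq x) = 0"
          using cross_skew[of "h g" x]
          by (simp add: f_iq[OF g] Lf'[OF g] qmul_iq inner_commute iq_minus scaleR_2)
        finally show ?thesis by (simp add: qmul.zero_left qmul.zero_right)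
      qed
      have one: "qreal 1 \<in> S3" by (simp add: S3_inner qreal_def)
      define B where "B = f (qreal 1)"
      have "qcnj (qreal 1) = qreal 1" by (simp add: qreal_def)
      then have G1: "G (qreal 1) = B" by (simp add: G_def B_def)
      have "f g = clifford g (qmul B g) (qreal 1)" if g: "g \<in> S3" for g
      proof -
        have "qmul (G g) g = qmul B g" using constant_on_S3[OF dG LG g] G1 by simp
        moreover have "qmul (G g) g = qmul g (f g)"
          using g by (simp add: G_def qmul_assoc qcnj_qmul_self S3_inner)
        ultimately show ?thesis using S3_cancel[OF g] by (simp add: clifford_def) metis
      qed
      moreover have "imq B" "norm B = 1"
        using re[OF one] True unit one by (auto simp: imq_def B_def)
      ultimately show ?thesis using c True by blast
    qed
  qed
qed

end
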